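(* Let $0<q<1$, $n\ge n_0+1$, and let $\ell$ be an even integer such that $\ell\ge2(n+\varkappa)$ and $$\frac{\rho^{\ell/2}}{1-\rho^{\ell}}<\frac{q\,m_K}{(4n+2)\,\delta_0\|p\|}.$$ Let $\widetilde p_1,\widetilde p_2$ be the polynomials computed (as described in the context) from the approximate Laurent coefficients $\widetilde c_k=\frac1\ell\sum_{j=0}^{\ell-1}\frac{1}{p(\omega_j)\omega_j^k}$, $\omega_j=e^{2\pi ij/\ell}$. Then $$\|p_1-\widetilde p_1\|<\frac{(4n-2)\,\delta_0\|p\|}{(1-q)m_K}\left[\frac{\delta_0(1+\rho)\|p\|}{(1-q)(1-\rho)m_K}+1\right]\frac{\rho^{\ell/2}}{1-\rho^{\ell}},$$ $$\|p_2-\widetilde p_2\|<\frac{(4n+2)\,\delta_0^2\|p\|^2}{(1-q)m_K}\,\frac{\rho^{\ell/2}}{1-\rho^{\ell}}.$$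
   Context: Let $p(z)$ be a monic complex polynomial of degree $\nu>1$ with $p(0)\ne0$ and with no zeros on the closed annulus $K=\{z\in\mathbb C: r\le|z|\le R\}$, where $0<r<1<R<\infty$. Let $\varkappa$ be the number of zeros of $p$ (with multiplicity) inside the unit circle; assume $0<\varkappa<\nu$, and put $n_0=\max\{\varkappa,\nu-\varkappa\}$. Write $p=p_1p_2$ where $p_1,p_2$ are monic, $\deg p_1=\varkappa$, $\deg p_2=\nu-\varkappa$, all zeros of $p_1$ lie in $\{|z|<r\}$ and all zeros of $p_2$ lie in $\{|z|>R\}$. Put $m_K=\min_{z\in K}|p(z)|$, $\rho=\max\{r,1/R\}$. The norm $\|\cdot\|$ of a polynomial is the sum of the absolute values of its coefficients. $\delta_0$ denotes any real number such that $\|p_1\|\,\|p_2\|\le\delta_0\|p\|$ and $1\le\delta_0\le\delta^{\nu}\sqrt{(\varkappa+1)(\nu-\varkappa+1)}$, where $\delta=e^{2G/\pi}$ and $G$ is Catalan's constant. For a finite sequence $\widetilde c_M^{\,N}=(\widetilde c_M,\ldots,\widetilde c_N)$ and $M\le k\le N$, $T_k(\widetilde c_M^{\,N})$ is the $(N-k+1)\times(k-M+1)$ Toeplitz matrix with $(i,j)$ entry $\widetilde c_{k+i-j}$ ($0\le i\le N-k$, $0\le j\le k-M$). Definition of $\widetilde p_1,\widetilde p_2$: let $\widetilde\alpha=(\widetilde\alpha_1,\ldots,\widetilde\alpha_n)^T$ and $\widetilde\beta=(\widetilde\beta_0,\ldots,\widetilde\beta_n)^T$ be the solutions of $$T_{-\varkappa}\left(\widetilde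 c_{-n-\varkappa+1}^{\,n-\varkappa-1}\right)\widetilde\alpha=-(\widetilde c_{-n-\varkappa},\ldots,\widetilde c_{-\varkappa-1})^T,\qquad T_{-\varkappa}\left(\widetilde c_{-n-\varkappa}^{\,n-\varkappa}\right)\widetilde\beta=(1,0,\ldots,0)^T,$$ and put $\widetilde p_1(z)=\widetilde\alpha_{n-\varkappa+1}+\cdots+\widetilde\alpha_nz^{\varkappa-1}+z^{\varkappa}$, $\widetilde p_2(z)=\widetilde\beta_0+\widetilde\beta_1z+\cdots+\widetilde\beta_{\nu-\varkappa}z^{\nu-\varkappa}$. *)

theory Defs
  imports
    Complex_Main
    "HOL-Computational_Algebra.Polynomial"
    "Jordan_Normal_Form.Matrix"
begin

definition annulus :: "real \<Rightarrow> real \<Rightarrow> complex set" where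
  "annulus r R = {z. r \<le> cmod z \<and> cmod z \<le> R}"

definition zeros_in_unit_disc :: "complex poly \<Rightarrow> nat" where
  "zeros_in_unit_disc p = (\<Sum>z | poly p z = 0 \<and> cmod z < 1. Polynomial.order z p)"

definition coeff_norm :: "complex poly \<Rightarrow> real" where
  "coeff_norm p = (\<Sum>i\<le>degree p. cmod (coeff p i))"

text \<open>On a nonempty compact set the infimum below is attained, so it is the minimum of the
  modulus of \<open>p\<close>.\<close>

definition min_modulus :: "complex poly \<Rightarrow> complex set \<Rightarrow> real" where
  "min_modulus p K = (INF z\<in>K. cmod (poly p z))"

definition catalan_const :: real where
  "catalan_const = (\<Sum>k. (- 1) ^ k / (2 * real k + 1)\<^sup>2)"

text \<open>A finite sequence with indices from \<open>M\<close> to \<open>N\<close> is given as a function on the integers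
  together with its bounds; for \<open>M \<le> k \<le> N\<close> only values at indices in that range enter the matrix.\<close>

definition toeplitz :: "(int \<Rightarrow> 'a) \<Rightarrow> int \<Rightarrow> int \<Rightarrow> int \<Rightarrow> 'a mat" where
  "toeplitz c M N k =
     mat (nat (N - k + 1)) (nat (k - M + 1)) (\<lambda>(i, j). c (k + int i - int j))"

definition root_of_unity :: "nat \<Rightarrow> nat \<Rightarrow> complex" where
  "root_of_unity l j = exp (2 * of_real pi * \<i> * of_nat j / of_nat l)"

definition approx_coeff :: "complex poly \<Rightarrow> nat \<Rightarrow> int \<Rightarrow> complex" where
  "approx_coeff p l k =
     1 / of_nat l *
       (\<Sum>j<l. 1 / (poly p (root_of_unity l j) * root_of_unity l j powi k))"

text \<open>The unknowns \<open>\<alpha>\<^sub>1, \<dots>, \<alpha>\<^sub>n\<close> are stored in a vector with indices \<open>0, \<dots>, n - 1\<close>, so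
  \<open>\<alpha>\<^sub>i\<close> is entry \<open>i - 1\<close>; the unknowns \<open>\<beta>\<^sub>0, \<dots>, \<beta>\<^sub>n\<close> keep their indices.\<close>

definition solves_alpha :: "(int \<Rightarrow> complex) \<Rightarrow> nat \<Rightarrow> nat \<Rightarrow> complex vec \<Rightarrow> bool" where
  "solves_alpha c n \<kappa> \<alpha> \<longleftrightarrow>
     \<alpha> \<in> carrier_vec n \<and>
     toeplitz c (- int n - int \<kappa> + 1) (int n - int \<kappa> - 1) (- int \<kappa>) *\<^sub>v \<alpha> =
       - vec n (\<lambda>i. c (- int n - int \<kappa> + int i))"

definition solves_beta :: "(int \<Rightarrow> complex) \<Rightarrow> nat \<Rightarrow> nat \<Rightarrow> complex vec \<Rightarrow> bool" where
  "solves_beta c n \<kappa> \<beta> \<longleftrightarrow>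
     \<beta> \<in> carrier_vec (n + 1) \<and>
     toeplitz c (- int n - int \<kappa>) (int n - int \<kappa>) (- int \<kappa>) *\<^sub>v \<beta> = unit_vec (n + 1) 0"

definition approx_p1 :: "nat \<Rightarrow> nat \<Rightarrow> complex vec \<Rightarrow> complex poly" where
  "approx_p1 n \<kappa> \<alpha> = (\<Sum>j<\<kappa>. monom (\<alpha> $ (n - \<kappa> + j)) j) + monom 1 \<kappa>"

definition approx_p2 :: "nat \<Rightarrow> nat \<Rightarrow> complex vec \<Rightarrow> complex poly" where
  "approx_p2 \<nu> \<kappa> \<beta> = (\<Sum>j\<le>\<nu> - \<kappa>. monom (\<beta> $ j) j)"

end

theory Submission
  imports Defs "HOL-Complex_Analysis.Cauchy_Integral_Formula" "Jordan_Normal_Form.Determinant"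
begin

unbundle no vec_syntax
hide_const (open) Finite_Cartesian_Product.mat Finite_Cartesian_Product.vec
hide_type (open) Finite_Cartesian_Product.vec

text \<open>
  Let \<open>1 / p = \<Sum> c\<^sub>k z\<^sup>k\<close> on the annulus. Cauchy's estimate gives \<open>\<bar>c\<^sub>k\<bar> \<le> \<rho>\<^bsup>\<bar>k\<bar>\<^esup> / m\<^sub>K\<close>, and since the approximate
  coefficient of index \<open>k\<close> is the sum of the \<open>c\<^sub>i\<close> with \<open>i \<equiv> k\<close> modulo \<open>l\<close>, it differs from \<open>c\<^sub>k\<close> by at most
  \<open>2 \<rho>\<^bsup>l/2\<^esup> / (m\<^sub>K (1 - \<rho>\<^sup>l))\<close> whenever \<open>2 \<bar>k\<bar> \<le> l\<close>. With the exact coefficients the two linear systems are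
  solved by the coefficients of \<open>p2\<close> and of \<open>p1\<close>, because \<open>p2 / p\<close> has only exponents \<open>\<le> -\<kappa>\<close> and \<open>p1 / p\<close> only
  exponents \<open>\<ge> 0\<close>. The same two facts yield an explicit inverse of the exact Toeplitz matrix whose \<open>1\<close>-norm is
  at most \<open>\<parallel>p1\<parallel> \<parallel>p2\<parallel> \<le> \<delta>0 \<parallel>p\<parallel>\<close>. The hypothesis on \<open>l\<close> makes the perturbation of the matrix smaller than
  \<open>q / (\<delta>0 \<parallel>p\<parallel>)\<close>, so the perturbed systems are uniquely solvable and the errors are bounded by standard
  perturbation theory.
\<close>

subsection \<open>Bilateral series on a circle\<close>

text \<open>One circle is enough: discrete averages over it recover the coefficients, and absolute
  summability there justifies forming products termwise.\<close>

definition laurent_on :: "(int \<Rightarrow> complex) \<Rightarrow> real \<Rightarrow> (complex \<Rightarrow> complex) \<Rightarrow> bool" where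
  "laurent_on a s f \<longleftrightarrow> s > 0 \<and> (\<lambda>k. cmod (a k) * s powi k) summable_on UNIV \<and>
     (\<forall>z. cmod z = s \<longrightarrow> ((\<lambda>k. a k * z powi k) has_sum f z) UNIV)"

text \<open>The Cauchy product of two bilateral series. The \<open>infsum\<close> is meaningful when
  both series converge absolutely on a common circle, or when \<open>a\<close> has finite
  support.\<close>

definition conv :: "(int \<Rightarrow> complex) \<Rightarrow> (int \<Rightarrow> complex) \<Rightarrow> int \<Rightarrow> complex" where
  "conv a b k = (\<Sum>\<^sub>\<infinity>j. a j * b (k - j))"

lemma cmod_root_of_unity [simp]: "cmod (root_of_unity N j) = 1"
proof -
  have "2 * of_real pi * \<i> * of_nat j / of_nat N = \<i> * of_real (2 * pi * j / N)"
    by simp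
  then show ?thesis
    unfolding root_of_unity_def by (simp only: norm_exp_i_times)
qed

text \<open>A geometric sum with ratio \<open>w\<close>: as \<open>w ^ N = 1\<close>, it vanishes
  unless \<open>w = 1\<close>, that is, unless \<open>N\<close> divides \<open>i\<close>.\<close>

lemma sum_root_of_unity_powi:
  assumes "N > 0"
  shows "(\<Sum>j<N. root_of_unity N j powi i) = (if int N dvd i then of_nat N else 0)"
proof -
  define w where "w = exp (2 * of_real pi * \<i> * of_int i / of_nat N)"
  have w: "root_of_unity N j powi i = w ^ j" for j
    unfolding root_of_unity_def w_def exp_power_int exp_of_nat_mult[symmetric]
    by (rule arg_cong[of _ _ exp]) simp
  have wN: "w ^ N = 1"
    unfolding w_def exp_of_nat_mult[symmetric] using assms
    by (simp add: exp_eq_1)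
  have "w = 1 \<longleftrightarrow> int N dvd i"
  proof -
    have im: "Im (2 * of_real pi * \<i> * of_int i / of_nat N) = 2 * pi * i / N"
      by (simp add: Im_divide_of_nat)
    have re: "Re (2 * of_real pi * \<i> * of_int i / of_nat N) = 0"
      by (simp add: Re_divide_of_nat)
    have "w = 1 \<longleftrightarrow> (\<exists>n::int. 2 * pi * i / N = of_int (2 * n) * pi)"
      unfolding w_def exp_eq_1 im re by simp
    also have "\<dots> \<longleftrightarrow> (\<exists>n::int. real_of_int i = of_int (int N * n))"
      using assms by (simp add: field_simps)
    also have "\<dots> \<longleftrightarrow> int N dvd i"
      unfolding of_int_eq_iff dvd_def ..
    finally show ?thesis .
  qed
  then show ?thesis
    unfolding w using wN by (auto simp: sum_gp_strict)
qed

lemma has_sum_finite_sum: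
  fixes f :: "'a \<Rightarrow> 'b \<Rightarrow> 'c::topological_comm_monoid_add"
  assumes "\<And>j. j \<in> J \<Longrightarrow> (f j has_sum S j) A"
  shows "((\<lambda>x. \<Sum>j\<in>J. f j x) has_sum (\<Sum>j\<in>J. S j)) A"
  using assms by (induction J rule: infinite_finite_induct) (auto intro: has_sum_add)

lemma has_sum_diff:
  fixes f g :: "'a \<Rightarrow> 'b::real_normed_vector"
  assumes "(f has_sum S) A" "(g has_sum T) A"
  shows "((\<lambda>x. f x - g x) has_sum (S - T)) A"
  using has_sum_add[OF assms(1), of "\<lambda>x. - g x" "- T"] assms(2) by (simp add: has_sum_uminus)

text \<open>Averaging over equally spaced points cancels every exponent not congruent to
  \<open>k\<close> modulo \<open>N\<close>. Large \<open>N\<close> isolates one coefficient;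
  \<open>s = 1\<close> and \<open>f = 1 / p\<close> give the aliasing formula for
  \<open>approx_coeff\<close>.\<close>

lemma discrete_average_has_sum:
  assumes "laurent_on a s f" and "N > 0"
  shows "((\<lambda>i. if int N dvd i - k then a i * of_real s powi (i - k) else 0) has_sum
           (1 / of_nat N * (\<Sum>j<N. f (of_real s * root_of_unity N j)
              / (of_real s * root_of_unity N j) powi k))) UNIV"
proof -
  define z where "z j = of_real s * root_of_unity N j" for j
  have s: "s > 0" using assms by (simp add: laurent_on_def)
  have zs: "cmod (z j) = s" for j using s by (simp add: z_def norm_mult)
  have z0: "z j \<noteq> 0" for j using zs[of j] s by auto
  have "((\<lambda>i. 1 / of_nat N * (\<Sum>j<N. a i * z j powi i / z j powi k)) has_sum
      (1 / of_nat N * (\<Sum>j<N. f (z j) / z j powi k))) UNIV"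
    using assms(1) zs unfolding laurent_on_def
    by (intro has_sum_cmult_right has_sum_finite_sum has_sum_divide_const) auto
  also have "(\<lambda>i. 1 / of_nat N * (\<Sum>j<N. a i * z j powi i / z j powi k)) =
      (\<lambda>i. if int N dvd i - k then a i * of_real s powi (i - k) else 0)"
  proof
    fix i
    have "a i * z j powi i / z j powi k = a i * of_real s powi (i - k) * root_of_unity N j powi (i - k)" for j
    proof -
      have "a i * z j powi i / z j powi k = a i * z j powi (i - k)"
        using z0[of j] by (simp add: power_int_diff)
      then show ?thesis by (simp add: z_def power_int_mult_distrib)
    qed
    then have "(\<Sum>j<N. a i * z j powi i / z j powi k) =
        a i * of_real s powi (i - k) * (\<Sum>j<N. root_of_unity N j powi (i - k))"
      by (simp add: sum_distrib_left)
    then show "1 / of_nat N * (\<Sum>j<N. a i * z j powi i / z j powi k) =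
        (if int N dvd i - k then a i * of_real s powi (i - k) else 0)"
      unfolding sum_root_of_unity_powi[OF assms(2)] using assms(2) by simp
  qed
  finally show ?thesis unfolding z_def .
qed

text \<open>Cauchy's estimate by discrete averages: each average is at most
  \<open>M * s powi (- k)\<close> in modulus, and suitable averages come arbitrarily close to
  \<open>a k\<close>.\<close>

lemma laurent_coeff_bound:
  assumes L: "laurent_on a s f" and M: "\<And>z. cmod z = s \<Longrightarrow> cmod (f z) \<le> M"
  shows "cmod (a k) * s powi k \<le> M"
proof -
  have s: "s > 0" using L by (simp add: laurent_on_def)
  define g where "g i = cmod (a i) * s powi (i - k)" for i
  have "(\<lambda>i. cmod (a i) * s powi i * s powi (- k)) summable_on UNIV"
    using L unfolding laurent_on_def by (intro summable_on_cmult_left) auto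
  then have gs: "g summable_on UNIV"
    unfolding g_def using s by (simp add: power_int_diff power_int_minus field_simps)
  have g0: "g i \<ge> 0" for i using s by (simp add: g_def)
  \<comment> \<open>Averaging over the \<open>N\<close>-th roots of unity isolates \<open>a k\<close> up to the aliased terms; for large \<open>N\<close> these
    avoid \<open>F\<close> and therefore lie in a small tail of the series.\<close>
  have "cmod (a k) \<le> M * s powi (- k) + e" if e: "e > 0" for e
  proof -
    obtain F where F: "finite F" "dist (sum g F) (infsum g UNIV) \<le> e"
      using infsum_finite_approximation[OF gs e] by auto
    \<comment> \<open>\<open>N\<close> exceeds the distance from \<open>k\<close> to every element
      of \<open>F\<close>, so no other element of \<open>F\<close> is congruent to \<open>k\<close>;
      the \<open>+ 1\<close> covers the case of a zero sum.\<close>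
    define N where "N = nat (\<Sum>i\<in>F. \<bar>i - k\<bar>) + 1"
    have N: "N > 0" by (simp add: N_def)
    have far: "\<not> int N dvd i - k" if "i \<in> F" "i \<noteq> k" for i
    proof
      assume "int N dvd i - k"
      then have "int N \<le> \<bar>i - k\<bar>" using that(2)
        by (metis diff_eq_diff_eq diff_self dvd_imp_le_int abs_of_nat right_minus_eq)
      moreover have "\<bar>i - k\<bar> \<le> (\<Sum>i\<in>F. \<bar>i - k\<bar>)"
        using F(1) that(1) by (intro member_le_sum) auto
      ultimately show False by (simp add: N_def)
    qed
    define A where "A = 1 / of_nat N * (\<Sum>j<N. f (of_real s * root_of_unity N j)
              / (of_real s * root_of_unity N j) powi k)"
    define h where "h i = (if int N dvd i - k then a i * of_real s powi (i - k) else 0)" for i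
    have hA: "(h has_sum A) UNIV"
      unfolding h_def A_def using discrete_average_has_sum[OF L N] .
    have "((\<lambda>i. if i = k then a k else 0) has_sum a k) UNIV"
      by (rule has_sum_finite_neutralI[of "{k}"]) auto
    then have d: "((\<lambda>i. h i - (if i = k then a k else 0)) has_sum (A - a k)) UNIV"
      using hA by (intro has_sum_diff)
    have hk: "h i - (if i = k then a k else 0) = (if i \<in> F \<or> i = k then 0 else h i)" for i
      using far[of i] by (auto simp: h_def)
    have gF: "((\<lambda>i. if i \<in> F then 0 else g i) has_sum (infsum g UNIV - sum g F)) UNIV"
    proof -
      have "((\<lambda>i. if i \<in> F then g i else 0) has_sum sum g F) UNIV"
        using F(1) by (intro has_sum_finite_neutralI[of F]) (auto intro!: sum.cong)
      then have "((\<lambda>i. g i - (if i \<in> F then g i else 0)) has_sum (infsum g UNIV - sum g F)) UNIV"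
        using gs by (intro has_sum_diff) auto
      then show ?thesis by (rule has_sum_cong[THEN iffD1, rotated]) auto
    qed
    have hg: "cmod (if i \<in> F \<or> i = k then 0 else h i) \<le> (if i \<in> F then 0 else g i)" for i
      using s g0[of i] by (auto simp: h_def g_def norm_mult norm_power_int)
    have "cmod (A - a k) \<le> infsum g UNIV - sum g F"
      using d gF hg unfolding hk by (rule norm_infsum_le)
    also have "\<dots> \<le> e" using F(2) by (simp add: dist_real_def)
    finally have 1: "cmod (A - a k) \<le> e" .
    have "cmod A \<le> 1 / N * (\<Sum>j<N. M * s powi (- k))"
      unfolding A_def norm_mult
      apply (rule mult_mono)
         apply (simp add: norm_divide)
        apply (rule sum_norm_le)
      using s M by (auto simp: norm_divide norm_mult norm_power_int power_int_minus field_simps)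
    also have "\<dots> = M * s powi (- k)" using N by simp
    finally have "cmod A \<le> M * s powi (- k)" .
    moreover have "cmod (a k) \<le> cmod A + cmod (A - a k)"
      by (metis norm_minus_commute norm_triangle_sub)
    ultimately show ?thesis using 1 by simp
  qed
  then have "cmod (a k) \<le> M * s powi (- k)"
    by (rule field_le_epsilon)
  then show ?thesis using s by (simp add: power_int_minus field_simps)
qed

text \<open>The difference of the two sequences expands the zero function, so the coefficient bound
  applies with \<open>M = 0\<close>.\<close>

lemma laurent_on_unique:
  assumes "laurent_on a s f" "laurent_on b s f"
  shows "a = b"
proof
  fix k
  have s: "s > 0" using assms by (simp add: laurent_on_def)
  have "laurent_on (\<lambda>k. a k - b k) s (\<lambda>_. 0)"
    unfolding laurent_on_def
  proof (intro conjI allI impI s)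
    have "(\<lambda>k. cmod (a k) * s powi k + cmod (b k) * s powi k) summable_on UNIV"
      using assms unfolding laurent_on_def by (intro summable_on_add) auto
    then have "(\<lambda>k. norm (cmod (a k - b k) * s powi k)) summable_on UNIV"
      by (rule Infinite_Sum.abs_summable_on_comparison_test')
        (use s in \<open>auto simp: abs_mult distrib_right[symmetric] norm_triangle_ineq4 intro!: mult_right_mono\<close>)
    then show "(\<lambda>k. cmod (a k - b k) * s powi k) summable_on UNIV"
      using s by simp
    fix z assume "cmod z = s"
    then have "((\<lambda>k. a k * z powi k - b k * z powi k) has_sum f z - f z) UNIV"
      using assms unfolding laurent_on_def by (intro has_sum_diff) auto
    then show "((\<lambda>k. (a k - b k) * z powi k) has_sum 0) UNIV"
      by (simp add: algebra_simps)
  qed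
  from laurent_coeff_bound[OF this, of 0 k] have "cmod (a k - b k) * s powi k \<le> 0" by simp
  moreover have "s powi k > 0" using s by simp
  ultimately have "cmod (a k - b k) \<le> 0"
    using mult_le_0_iff by (metis less_le_not_le)
  then show "a k = b k" by simp
qed

lemma laurent_on_cong:
  assumes "laurent_on a s f" "\<And>z. cmod z = s \<Longrightarrow> f z = g z"
  shows "laurent_on a s g"
  using assms by (simp add: laurent_on_def)

text \<open>The double family of products is absolutely summable, so it may be summed by rows, which
  gives \<open>f z * g z\<close>, or along \<open>i + j = k\<close>, which gives the
  convolution.\<close>

lemma laurent_on_conv:
  assumes A: "laurent_on a s f" and B: "laurent_on b s g"
  shows "laurent_on (conv a b) s (\<lambda>z. f z * g z)"
proof -
  have s: "s > 0" using A by (simp add: laurent_on_def)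
  define \<alpha> where "\<alpha> k = cmod (a k) * s powi k" for k
  define \<beta> where "\<beta> k = cmod (b k) * s powi k" for k
  have as: "\<alpha> summable_on UNIV" and bs: "\<beta> summable_on UNIV"
    using A B by (auto simp: laurent_on_def \<alpha>_def[abs_def] \<beta>_def[abs_def])
  have nn: "\<alpha> k \<ge> 0" "\<beta> k \<ge> 0" for k using s by (auto simp: \<alpha>_def \<beta>_def)
  have prod: "(\<lambda>(i, j). \<alpha> i * \<beta> j) summable_on UNIV \<times> UNIV"
  proof -
    have "(\<lambda>x. norm (case x of (i, j) \<Rightarrow> \<alpha> i * \<beta> j)) summable_on (SIGMA i:UNIV. UNIV)"
      apply (rule Infinite_Sum.abs_summable_on_Sigma_iff[THEN iffD2])
      using as bs nn by (auto simp: abs_mult infsum_cmult_right intro!: summable_on_cmult_right summable_on_cmult_left infsum_nonneg)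
    then show ?thesis using nn by (simp add: case_prod_unfold abs_mult)
  qed
  have bij: "bij_betw (\<lambda>(k, i). (i, k - i)) (UNIV \<times> UNIV) (UNIV \<times> (UNIV :: int set))"
    by (rule bij_betwI[of _ _ _ "\<lambda>(i, j). (i + j, i)"]) auto
  have reidx: "(\<lambda>(k, i). \<alpha> i * \<beta> (k - i)) summable_on UNIV \<times> UNIV"
    using summable_on_reindex_bij_betw[OF bij, of "\<lambda>(i, j). \<alpha> i * \<beta> j"] prod
    by (simp add: case_prod_unfold)
  have S: "(\<lambda>i. \<alpha> i * \<beta> (k - i)) summable_on UNIV"
    and S': "(\<lambda>k. \<Sum>\<^sub>\<infinity>i. \<alpha> i * \<beta> (k - i)) summable_on UNIV" for k
    using summable_on_Sigma_banach[OF reidx] summable_on_SigmaD1[OF reidx]  by auto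
  have tm: "a i * z powi i * (b (k - i) * z powi (k - i)) = a i * b (k - i) * z powi k"
    if "cmod z = s" for z i k
  proof -
    have "z \<noteq> 0" using that s by auto
    then have "z powi k = z powi i * z powi (k - i)" by (simp add: power_int_add[symmetric])
    then show ?thesis by simp
  qed
  have nterm: "\<alpha> i * \<beta> (k - i) = cmod (a i * b (k - i)) * s powi k" for i k
  proof -
    have "s powi k = s powi i * s powi (k - i)" using s by (simp add: power_int_add[symmetric])
    then show ?thesis by (simp add: \<alpha>_def \<beta>_def norm_mult)
  qed
  have Sa: "(\<lambda>i. norm (a i * b (k - i))) summable_on UNIV" for k
  proof -
    have "s powi k \<noteq> 0" using s by simp
    then show ?thesis
      using S[of k] unfolding nterm by (simp only: summable_on_cmult_left' not_False_eq_True)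
  qed
  then have cs: "((\<lambda>i. a i * b (k - i)) has_sum conv a b k) UNIV" for k
    unfolding conv_def by (rule has_sum_infsum[OF abs_summable_summable])
  show ?thesis
    unfolding laurent_on_def
  proof (intro conjI allI impI s)
    have "(\<lambda>k. norm (cmod (conv a b k) * s powi k)) summable_on UNIV"
    proof (rule Infinite_Sum.abs_summable_on_comparison_test'[OF S'])
      fix k
      have "cmod (conv a b k) \<le> (\<Sum>\<^sub>\<infinity>i. norm (a i * b (k - i)))"
        unfolding conv_def using Sa by (rule norm_infsum_bound)
      then have "cmod (conv a b k) * s powi k \<le> (\<Sum>\<^sub>\<infinity>i. norm (a i * b (k - i))) * s powi k"
        using s by (intro mult_right_mono) auto
      also have "\<dots> = (\<Sum>\<^sub>\<infinity>i. \<alpha> i * \<beta> (k - i))"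
        unfolding nterm by (rule infsum_cmult_left'[symmetric])
      finally show "norm (cmod (conv a b k) * s powi k) \<le> (\<Sum>\<^sub>\<infinity>i. \<alpha> i * \<beta> (k - i))"
        using s by simp
    qed
    then show "(\<lambda>k. cmod (conv a b k) * s powi k) summable_on UNIV" using s by simp
  next
    fix z assume z: "cmod z = s"
    define F where "F = (\<lambda>(i, j). a i * z powi i * (b j * z powi j))"
    have "(\<lambda>x. norm (F x)) summable_on UNIV \<times> UNIV"
      using prod by (simp add: F_def case_prod_unfold norm_mult norm_power_int z \<alpha>_def \<beta>_def)
    then have "F summable_on UNIV \<times> UNIV" by (rule abs_summable_summable)
    then obtain T where T: "(F has_sum T) (UNIV \<times> UNIV)" using summable_on_def by blast
    have fa: "((\<lambda>k. a k * z powi k) has_sum f z) UNIV" and gb: "((\<lambda>k. b k * z powi k) has_sum g z) UNIV"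
      using A B z by (auto simp: laurent_on_def)
    have "((\<lambda>i. a i * z powi i * g z) has_sum T) UNIV"
      by (rule has_sum_Sigma'[OF T]) (auto simp: F_def intro: has_sum_cmult_right[OF gb])
    moreover have "((\<lambda>i. a i * z powi i * g z) has_sum f z * g z) UNIV"
      by (rule has_sum_cmult_left[OF fa])
    ultimately have "T = f z * g z" by (rule has_sum_unique)
    with T have "((\<lambda>(k, i). F (i, k - i)) has_sum f z * g z) (UNIV \<times> UNIV)"
      using has_sum_reindex_bij_betw[OF bij, of F] by (simp add: case_prod_unfold)
    then have "((\<lambda>(k, i). a i * b (k - i) * z powi k) has_sum f z * g z) (UNIV \<times> UNIV)"
      by (simp add: F_def tm[OF z] case_prod_unfold)
    then show "((\<lambda>k. conv a b k * z powi k) has_sum f z * g z) UNIV"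
      by (rule has_sum_Sigma') (auto intro: has_sum_cmult_left[OF cs])
  qed
qed

subsection \<open>Laurent coefficients of the reciprocal of a polynomial\<close>

text \<open>Substituting \<open>1 / z\<close> exchanges expansions at the origin and at infinity;
  this is how the factor with zeros inside the circle is reduced to a power series.\<close>

lemma laurent_on_reflect:
  assumes "laurent_on a s f"
  shows "laurent_on (\<lambda>k. a (- k)) (1 / s) (\<lambda>z. f (1 / z))"
proof -
  have s: "s > 0" using assms by (simp add: laurent_on_def)
  have bij: "bij_betw uminus (UNIV :: int set) UNIV" by (rule bij_uminus)
  show ?thesis
    unfolding laurent_on_def
  proof (intro conjI allI impI)
    show "1 / s > 0" using s by simp
    have "(\<lambda>k. cmod (a (- k)) * s powi (- k)) summable_on UNIV"
      using summable_on_reindex_bij_betw[OF bij, of "\<lambda>k. cmod (a k) * s powi k"] assms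
      by (simp add: laurent_on_def)
    moreover have "s powi (- k) = (1 / s) powi k" for k
      by (simp add: power_int_minus divide_inverse power_int_inverse)
    ultimately show "(\<lambda>k. cmod (a (- k)) * (1 / s) powi k) summable_on UNIV" by simp
  next
    fix z assume "cmod z = 1 / s"
    then have "cmod (1 / z) = s" by (simp add: norm_divide)
    then have "((\<lambda>k. a k * (1 / z) powi k) has_sum f (1 / z)) UNIV"
      using assms unfolding laurent_on_def by blast
    then have "((\<lambda>k. a (- k) * (1 / z) powi (- k)) has_sum f (1 / z)) UNIV"
      using has_sum_reindex_bij_betw[OF bij, of "\<lambda>k. a k * (1 / z) powi k"] by simp
    moreover have "(1 / z) powi (- k) = z powi k" for k
      by (simp add: power_int_minus divide_inverse power_int_inverse)
    ultimately show "((\<lambda>k. a (- k) * z powi k) has_sum f (1 / z)) UNIV" by simp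
  qed
qed

lemma laurent_on_shift:
  assumes "laurent_on a s f"
  shows "laurent_on (\<lambda>k. a (k + m)) s (\<lambda>z. z powi (- m) * f z)"
proof -
  have s: "s > 0" using assms by (simp add: laurent_on_def)
  have bij: "bij_betw (\<lambda>k. k + m) UNIV UNIV"
    by (rule bij_betwI[of _ _ _ "\<lambda>k. k - m"]) auto
  show ?thesis
    unfolding laurent_on_def
  proof (intro conjI allI impI s)
    have "(\<lambda>k. s powi (- m) * (cmod (a (k + m)) * s powi (k + m))) summable_on UNIV"
      using summable_on_reindex_bij_betw[OF bij, of "\<lambda>k. cmod (a k) * s powi k"] assms
      by (intro summable_on_cmult_right) (simp add: laurent_on_def)
    moreover have "s powi (- m) * (cmod (a (k + m)) * s powi (k + m)) = cmod (a (k + m)) * s powi k" for k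
      using s by (simp add: power_int_add power_int_minus)
    ultimately show "(\<lambda>k. cmod (a (k + m)) * s powi k) summable_on UNIV" by simp
  next
    fix z assume z: "cmod z = s"
    then have z0: "z \<noteq> 0" using s by auto
    from z have "((\<lambda>k. a k * z powi k) has_sum f z) UNIV"
      using assms unfolding laurent_on_def by blast
    then have "((\<lambda>k. z powi (- m) * (a (k + m) * z powi (k + m))) has_sum z powi (- m) * f z) UNIV"
      using has_sum_reindex_bij_betw[OF bij, of "\<lambda>k. a k * z powi k"]
      by (intro has_sum_cmult_right) simp
    moreover have "z powi (- m) * (a (k + m) * z powi (k + m)) = a (k + m) * z powi k" for k
      using z0 by (simp add: power_int_add power_int_minus)
    ultimately show "((\<lambda>k. a (k + m) * z powi k) has_sum z powi (- m) * f z) UNIV" by simp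
  qed
qed

definition fps_seq :: "complex fps \<Rightarrow> int \<Rightarrow> complex" where
  "fps_seq F k = (if k \<ge> 0 then fps_nth F (nat k) else 0)"

definition poly_seq :: "complex poly \<Rightarrow> int \<Rightarrow> complex" where
  "poly_seq P = fps_seq (fps_of_poly P)"

lemma laurent_on_fps:
  assumes "s > 0" and "ereal s < fps_conv_radius F"
  shows "laurent_on (fps_seq F) s (eval_fps F)"
proof -
  have bij: "bij_betw int UNIV {0..}"
    by (rule bij_betwI[of _ _ _ nat]) auto
  have sm: "summable (\<lambda>n. cmod (fps_nth F n * of_real s ^ n))"
    using assms unfolding fps_conv_radius_def by (intro abs_summable_in_conv_radius) simp
  show ?thesis
    unfolding laurent_on_def
  proof (intro conjI allI impI assms(1))
    have "(\<lambda>n. cmod (fps_nth F n) * s ^ n) summable_on UNIV"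
      using sm assms by (intro norm_summable_imp_summable_on) (simp add: norm_mult norm_power abs_mult)
    then have "(\<lambda>n. cmod (fps_seq F (int n)) * s powi (int n)) summable_on UNIV"
      by (simp add: fps_seq_def)
    then have "(\<lambda>k. cmod (fps_seq F k) * s powi k) summable_on {0..}"
      using summable_on_reindex_bij_betw[OF bij, of "\<lambda>k. cmod (fps_seq F k) * s powi k"] by simp
    then show "(\<lambda>k. cmod (fps_seq F k) * s powi k) summable_on UNIV"
      by (rule summable_on_cong_neutral[THEN iffD1, rotated -1]) (auto simp: fps_seq_def)
  next
    fix z assume z: "cmod z = s"
    have "summable (\<lambda>n. norm (fps_nth F n * z ^ n))"
      using sm z assms(1) by (simp add: norm_mult norm_power)
    moreover have "(\<lambda>n. fps_nth F n * z ^ n) sums eval_fps F z"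
      using assms z by (intro sums_eval_fps) auto
    ultimately have "((\<lambda>n. fps_nth F n * z ^ n) has_sum eval_fps F z) UNIV"
      by (rule norm_summable_imp_has_sum)
    then have "((\<lambda>n. fps_seq F (int n) * z powi (int n)) has_sum eval_fps F z) UNIV"
      by (simp add: fps_seq_def)
    then have "((\<lambda>k. fps_seq F k * z powi k) has_sum eval_fps F z) {0..}"
      using has_sum_reindex_bij_betw[OF bij, of "\<lambda>k. fps_seq F k * z powi k"] by simp
    then show "((\<lambda>k. fps_seq F k * z powi k) has_sum eval_fps F z) UNIV"
      by (rule has_sum_cong_neutral[THEN iffD1, rotated -1]) (auto simp: fps_seq_def)
  qed
qed

lemma laurent_on_poly: "s > 0 \<Longrightarrow> laurent_on (poly_seq P) s (poly P)"
  unfolding poly_seq_def by (rule laurent_on_cong[OF laurent_on_fps]) auto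

lemma conv_poly_seq: "conv (poly_seq P) c k = (\<Sum>i\<le>degree P. coeff P i * c (k - int i))"
proof -
  have "((\<lambda>j. poly_seq P j * c (k - j)) has_sum (\<Sum>j\<in>int ` {..degree P}. poly_seq P j * c (k - j))) UNIV"
  proof (rule has_sum_finite_neutralI)
    fix j assume "j \<in> UNIV - int ` {..degree P}"
    then have "j < 0 \<or> degree P < nat j"
      by (metis DiffE atMost_iff imageI int_nat_eq not_le)
    then show "poly_seq P j * c (k - j) = 0"
      by (auto simp: poly_seq_def fps_seq_def coeff_eq_0)
  qed auto
  also have "(\<Sum>j\<in>int ` {..degree P}. poly_seq P j * c (k - j)) = (\<Sum>i\<le>degree P. coeff P i * c (k - int i))"
    by (subst sum.reindex) (auto simp: poly_seq_def fps_seq_def)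
  finally show ?thesis unfolding conv_def by (rule infsumI)
qed

text \<open>Since \<open>P\<close> has no zero in the open disc of radius \<open>R\<close>, the
  inverse power series has radius of convergence at least \<open>R\<close>.\<close>

lemma laurent_on_inverse_zeros_outside:
  assumes "0 < s" "s < R" and nz: "\<And>z. cmod z < R \<Longrightarrow> poly P z \<noteq> 0"
  shows "laurent_on (fps_seq (inverse (fps_of_poly P))) s (\<lambda>z. 1 / poly P z)"
proof -
  have nz': "eval_fps (fps_of_poly P) z \<noteq> 0" if "ereal (norm z) < ereal R" for z
    using nz that by simp
  have "fps_conv_radius (inverse (fps_of_poly P)) \<ge> min (ereal R) (fps_conv_radius (fps_of_poly P))"
    by (rule fps_conv_radius_inverse[OF nz'])
  then have "fps_conv_radius (inverse (fps_of_poly P)) \<ge> ereal R" by simp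
  then have "ereal s < fps_conv_radius (inverse (fps_of_poly P))"
    using assms(2) by (meson ereal_less_eq(3) less_ereal.simps(1) order_less_le_trans)
  from laurent_on_fps[OF assms(1) this] show ?thesis
  proof (rule laurent_on_cong)
    fix z :: complex assume "cmod z = s"
    then show "eval_fps (inverse (fps_of_poly P)) z = 1 / poly P z"
      using assms(2) eval_fps_inverse[where r = "ereal R", OF nz'] by (simp add: divide_inverse)
  qed
qed

text \<open>With \<open>Q = reflect_poly P\<close>, the reciprocal of \<open>P\<close> at
  \<open>z\<close> is \<open>z powi (- degree P)\<close> times that of \<open>Q\<close> at
  \<open>1 / z\<close>, and \<open>Q\<close> has no zero in the open disc of radius
  \<open>1 / r\<close>. Hence only exponents up to \<open>- degree P\<close> occur.\<close>

lemma laurent_on_inverse_zeros_inside: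
  assumes "0 < r" "r < s" and nz: "\<And>z. cmod z > r \<Longrightarrow> poly P z \<noteq> 0"
  shows "laurent_on (\<lambda>k. fps_seq (inverse (fps_of_poly (reflect_poly P))) (- k - int (degree P))) s
           (\<lambda>z. 1 / poly P z)"
proof -
  define Q where "Q = reflect_poly P"
  have P0: "P \<noteq> 0" using nz[of "of_real (r + 1)"] assms(1) by auto
  have nzQ: "poly Q z \<noteq> 0" if "cmod z < 1 / r" for z
  proof (cases "z = 0")
    case True
    then show ?thesis using P0 by (simp add: Q_def)
  next
    case False
    then have "r < 1 / cmod z"
      using that assms(1) by (simp add: field_simps)
    then have "cmod (inverse z) > r"
      by (simp add: norm_inverse divide_inverse)
    then show ?thesis using nz[of "inverse z"] False by (simp add: Q_def poly_reflect_poly_nz)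
  qed
  have "1 / s < 1 / r" "0 < 1 / s" using assms by (auto simp: field_simps)
  from laurent_on_inverse_zeros_outside[OF this(2,1) nzQ]
  have "laurent_on (fps_seq (inverse (fps_of_poly Q))) (1 / s) (\<lambda>z. 1 / poly Q z)" by blast
  from laurent_on_shift[OF laurent_on_reflect[OF this], of "int (degree P)"]
  have "laurent_on (\<lambda>k. fps_seq (inverse (fps_of_poly Q)) (- (k + int (degree P)))) s
       (\<lambda>z. z powi (- int (degree P)) * (1 / poly Q (1 / z)))" by simp
  then have "laurent_on (\<lambda>k. fps_seq (inverse (fps_of_poly Q)) (- k - int (degree P))) s
       (\<lambda>z. z powi (- int (degree P)) * (1 / poly Q (1 / z)))" by simp
  then show ?thesis
    unfolding Q_def
  proof (rule laurent_on_cong)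
    fix z assume "cmod z = s"
    then have "z \<noteq> 0" using assms by auto
    then show "z powi (- int (degree P)) * (1 / poly (reflect_poly P) (1 / z)) = 1 / poly P z"
      by (simp add: poly_reflect_poly_nz power_int_minus field_simps)
  qed
qed

text \<open>\<open>c\<close> is the convolution of the expansions \<open>u\<close> of
  \<open>1 / p1\<close> and \<open>v\<close> of \<open>1 / p2\<close>. Uniqueness on the unit circle
  turns \<open>p1 / p = 1 / p2\<close>, \<open>p2 / p = 1 / p1\<close> and
  \<open>p2 * (1 / p2) = 1\<close> into identities of sequences, and the supports are read off from
  \<open>v\<close> and \<open>u\<close>.\<close>

lemma laurent_coeffs_inverse_factorization:
  fixes p p1 p2 :: "complex poly"
  assumes rR: "0 < r" "r < 1" "1 < R"
    and monic: "lead_coeff p1 = 1"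
    and p: "p = p1 * p2" and deg: "degree p1 = \<kappa>"
    and z1: "\<forall>z. poly p1 z = 0 \<longrightarrow> cmod z < r"
    and z2: "\<forall>z. poly p2 z = 0 \<longrightarrow> cmod z > R"
  obtains c where
    "\<And>s. r < s \<Longrightarrow> s < R \<Longrightarrow> laurent_on c s (\<lambda>z. 1 / poly p z)"
    "\<And>k. k < 0 \<Longrightarrow> conv (poly_seq p1) c k = 0"
    "\<And>k. k > - int \<kappa> \<Longrightarrow> conv (poly_seq p2) c k = 0"
    "conv (poly_seq p2) c (- int \<kappa>) = 1"
    "\<And>k. conv (poly_seq p2) (conv (poly_seq p1) c) k = (if k = 0 then 1 else 0)"
proof -
  define v where "v = fps_seq (inverse (fps_of_poly p2))"
  define u where "u k = fps_seq (inverse (fps_of_poly (reflect_poly p1))) (- k - int \<kappa>)" for k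
  define c where "c = conv u v"
  have nz1: "poly p1 z \<noteq> 0" if "cmod z > r" for z using z1 that by force
  have nz2: "poly p2 z \<noteq> 0" if "cmod z < R" for z using z2 that by force
  have Lu: "laurent_on u s (\<lambda>z. 1 / poly p1 z)" if "r < s" for s
    unfolding u_def deg[symmetric] using laurent_on_inverse_zeros_inside[OF rR(1) that nz1] .
  have Lv: "laurent_on v s (\<lambda>z. 1 / poly p2 z)" if "0 < s" "s < R" for s
    unfolding v_def using laurent_on_inverse_zeros_outside[OF that nz2] .
  have Lc: "laurent_on c s (\<lambda>z. 1 / poly p z)" if "r < s" "s < R" for s
    unfolding c_def using laurent_on_conv[OF Lu Lv, of s] that rR
    by (simp add: p divide_inverse)
  have "laurent_on (conv (poly_seq p1) c) 1 (\<lambda>z. 1 / poly p2 z)"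
    using rR nz1 by (intro laurent_on_cong[OF laurent_on_conv[OF laurent_on_poly Lc]]) (auto simp: p)
  then have 1: "conv (poly_seq p1) c = v"
    using laurent_on_unique Lv[of 1] rR by auto
  have "laurent_on (conv (poly_seq p2) c) 1 (\<lambda>z. 1 / poly p1 z)"
    using rR nz2 by (intro laurent_on_cong[OF laurent_on_conv[OF laurent_on_poly Lc]]) (auto simp: p)
  then have 2: "conv (poly_seq p2) c = u"
    using laurent_on_unique Lu[of 1] rR by auto
  have "laurent_on (conv (poly_seq p2) v) 1 (poly 1)"
    using rR nz2 by (intro laurent_on_cong[OF laurent_on_conv[OF laurent_on_poly Lv]]) auto
  then have 3: "conv (poly_seq p2) v = poly_seq 1"
    using laurent_on_unique laurent_on_poly[of 1] by auto
  show thesis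
  proof (rule that[OF Lc])
    show "conv (poly_seq p1) c k = 0" if "k < 0" for k
      using that unfolding 1 by (simp add: v_def fps_seq_def)
    show "conv (poly_seq p2) c k = 0" if "k > - int \<kappa>" for k
      using that unfolding 2 by (simp add: u_def fps_seq_def)
    \<comment> \<open>This entry is the constant coefficient of the inverse of the reflected
      \<open>p1\<close>, hence the reciprocal of the leading coefficient of
      \<open>p1\<close>.\<close>
    show "conv (poly_seq p2) c (- int \<kappa>) = 1"
      unfolding 2 using monic by (simp add: u_def fps_seq_def)
    show "conv (poly_seq p2) (conv (poly_seq p1) c) k = (if k = 0 then 1 else 0)" for k
      unfolding 1 3 by (auto simp: poly_seq_def fps_seq_def)
  qed
qed

text \<open>Cauchy's estimate holds on circles strictly inside the annulus; then \<open>s\<close>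
  tends to \<open>R\<close> for \<open>k \<ge> 0\<close> and to \<open>r\<close> for
  \<open>k < 0\<close>.\<close>

lemma laurent_coeff_decay:
  assumes rR: "0 < r" "r < 1" "1 < R" and m: "m > 0"
    and L: "\<And>s. r < s \<Longrightarrow> s < R \<Longrightarrow> laurent_on c s (\<lambda>z. 1 / poly p z)"
    and M: "\<And>z. z \<in> annulus r R \<Longrightarrow> m \<le> cmod (poly p z)"
  shows "cmod (c k) \<le> max r (1 / R) ^ nat \<bar>k\<bar> / m"
proof -
  have b: "cmod (c k) * s powi k \<le> 1 / m" if "r < s" "s < R" for s
  proof (rule laurent_coeff_bound[OF L[OF that]])
    fix z assume "cmod z = s"
    then have "m \<le> cmod (poly p z)" using that by (intro M) (auto simp: annulus_def)
    then show "cmod (1 / poly p z) \<le> 1 / m" using m by (simp add: norm_divide frac_le)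
  qed
  show ?thesis
  proof (cases "k \<ge> 0")
    case True
    then obtain n where k: "k = int n" using nonneg_int_cases by auto
    have "((\<lambda>s. cmod (c k) * s ^ n) \<longlongrightarrow> cmod (c k) * R ^ n) (at_left R)"
      by (intro tendsto_intros)
    moreover have "\<forall>\<^sub>F s in at_left R. cmod (c k) * s ^ n \<le> 1 / m"
      using eventually_at_left_real[of r R] b rR by (auto simp: k elim!: eventually_mono)
    ultimately have "cmod (c k) * R ^ n \<le> 1 / m"
      by (rule tendsto_upperbound) simp
    then have "cmod (c k) \<le> (1 / R) ^ n / m"
      using rR m by (simp add: field_simps)
    also have "\<dots> \<le> max r (1 / R) ^ n / m"
      using rR m by (intro divide_right_mono power_mono) auto
    finally show ?thesis using k by simp
  next
    case False
    define n where "n = nat (- k)"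
    have k: "k = - int n" using False by (simp add: n_def)
    have "((\<lambda>s. cmod (c k) * (1 / s) ^ n) \<longlongrightarrow> cmod (c k) * (1 / r) ^ n) (at_right r)"
      using rR by (intro tendsto_intros) auto
    moreover have "\<forall>\<^sub>F s in at_right r. cmod (c k) * (1 / s) ^ n \<le> 1 / m"
    proof (rule eventually_mono[OF eventually_at_right_real[of r R]])
      show "r < R" using rR by simp
      fix s assume s: "s \<in> {r<..<R}"
      have "s powi k = (1 / s) ^ n" by (simp add: k power_int_minus divide_inverse power_inverse)
      then show "cmod (c k) * (1 / s) ^ n \<le> 1 / m" using b[of s] s by simp
    qed
    ultimately have "cmod (c k) * (1 / r) ^ n \<le> 1 / m"
      by (rule tendsto_upperbound) simp
    then have "cmod (c k) \<le> r ^ n / m"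
      using rR m by (simp add: field_simps)
    also have "\<dots> \<le> max r (1 / R) ^ n / m"
      using rR m by (intro divide_right_mono power_mono) auto
    finally show ?thesis using k by simp
  qed
qed

subsection \<open>Aliasing error of the approximate coefficients\<close>

lemma approx_coeff_has_sum:
  assumes "laurent_on c 1 (\<lambda>z. 1 / poly p z)" and "l > 0"
  shows "(c has_sum approx_coeff p l k) {i. int l dvd i - k}"
proof -
  have "((\<lambda>i. if int l dvd i - k then c i else 0) has_sum approx_coeff p l k) UNIV"
    using discrete_average_has_sum[OF assms, of k]
    by (simp add: approx_coeff_def divide_inverse mult.commute cong: if_cong)
  then show ?thesis
    by (rule has_sum_cong_neutral[THEN iffD1, rotated -1]) auto
qed

text \<open>For \<open>n \<ge> 1\<close> the bound on \<open>k\<close> makes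
  \<open>k + l * n\<close> nonnegative, so the absolute value disappears and a geometric series
  remains.\<close>

lemma has_sum_geometric_shifted:
  fixes \<rho> :: real and k :: int
  assumes "0 < \<rho>" "\<rho> < 1" "0 < l" "2 * \<bar>k\<bar> \<le> int l"
  shows "((\<lambda>n. \<rho> ^ nat \<bar>k + int l * int n\<bar>) has_sum \<rho> powi k * (\<rho> ^ l / (1 - \<rho> ^ l))) {1..}"
proof -
  have "\<rho> ^ l < 1" using assms by (simp add: power_less_one_iff)
  then have "((\<lambda>n. \<rho> powi k * (\<rho> ^ l) ^ n) has_sum \<rho> powi k * (\<rho> ^ l / (1 - \<rho> ^ l))) {1..}"
    using assms by (intro has_sum_cmult_right has_sum_geometric_from_1) simp
  moreover have "\<rho> powi k * (\<rho> ^ l) ^ n = \<rho> ^ nat \<bar>k + int l * int n\<bar>" if "n \<in> {1..}" for n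
  proof -
    have "int l \<le> int l * int n" using that mult_left_mono[of 1 "int n" "int l"] by simp
    then have ge: "k + int l * int n \<ge> 0" using assms by linarith
    have "(\<rho> ^ l) ^ n = \<rho> powi (int l * int n)"
      by (metis of_nat_mult power_int_of_nat power_mult)
    then have "\<rho> powi k * (\<rho> ^ l) ^ n = \<rho> powi (k + int l * int n)"
      using assms by (simp add: power_int_add)
    also have "\<dots> = \<rho> ^ nat \<bar>k + int l * int n\<bar>"
      using ge by (simp add: power_int_def)
    finally show ?thesis .
  qed
  ultimately show ?thesis by (rule has_sum_cong[THEN iffD1, rotated]) auto
qed

text \<open>The aliased indices other than \<open>k\<close> are \<open>k + l * n\<close> and
  \<open>k - l * n\<close> with \<open>n \<ge> 1\<close>. Each side is a geometric sum, and the two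
  sides account for the factor 2.\<close>

lemma approx_coeff_error:
  assumes L: "laurent_on c 1 (\<lambda>z. 1 / poly p z)"
    and decay: "\<And>k. cmod (c k) \<le> \<rho> ^ nat \<bar>k\<bar> / m"
    and \<rho>: "0 < \<rho>" "\<rho> < 1" and "m > 0" and l: "0 < l" "even l" "2 * \<bar>k\<bar> \<le> int l"
  shows "cmod (approx_coeff p l k - c k) \<le> 2 / m * (\<rho> ^ (l div 2) / (1 - \<rho> ^ l))"
proof -
  define P where "P = {i. int l dvd i - k \<and> i > k}"
  define Q where "Q = {i. int l dvd i - k \<and> i < k}"
  define G where "G = \<rho> ^ l / (1 - \<rho> ^ l)"
  have bijP: "bij_betw (\<lambda>n. k + int l * int n) {1..} P"
    unfolding P_def
  proof (rule bij_betwI[of _ _ _ "\<lambda>i. nat ((i - k) div int l)"])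
    show "(\<lambda>i. nat ((i - k) div int l)) \<in> {i. int l dvd i - k \<and> k < i} \<rightarrow> {1..}"
    proof
      fix i assume i: "i \<in> {i. int l dvd i - k \<and> k < i}"
      then have "(i - k) div int l > 0" using l by (simp add: pos_imp_zdiv_pos_iff zdvd_imp_le)
      then show "nat ((i - k) div int l) \<in> {1..}" by simp
    qed
  qed (use l in \<open>auto simp: pos_imp_zdiv_nonneg_iff\<close>)
  have bijQ: "bij_betw (\<lambda>n. k - int l * int n) {1..} Q"
    unfolding Q_def
  proof (rule bij_betwI[of _ _ _ "\<lambda>i. nat ((k - i) div int l)"])
    show "(\<lambda>i. nat ((k - i) div int l)) \<in> {i. int l dvd i - k \<and> i < k} \<rightarrow> {1..}"
    proof
      fix i assume i: "i \<in> {i. int l dvd i - k \<and> i < k}"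
      then have "int l dvd k - i" using dvd_diff_commute by blast
      with i have "(k - i) div int l > 0" using l by (simp add: pos_imp_zdiv_pos_iff zdvd_imp_le)
      then show "nat ((k - i) div int l) \<in> {1..}" by simp
    qed
    fix i assume i: "i \<in> {i. int l dvd i - k \<and> i < k}"
    then have "int l dvd k - i" using dvd_diff_commute by blast
    then have "int l * ((k - i) div int l) = k - i" by simp
    moreover have "(k - i) div int l \<ge> 0" using i l by (simp add: pos_imp_zdiv_nonneg_iff)
    ultimately show "k - int l * int (nat ((k - i) div int l)) = i" by simp
  qed (use l in auto)
  have "((\<lambda>i. \<rho> ^ nat \<bar>i\<bar>) has_sum \<rho> powi k * G) P"
    using has_sum_geometric_shifted[OF \<rho> l(1,3)] has_sum_reindex_bij_betw[OF bijP, of "\<lambda>i. \<rho> ^ nat \<bar>i\<bar>"]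
    by (simp add: G_def)
  moreover have "((\<lambda>i. \<rho> ^ nat \<bar>i\<bar>) has_sum \<rho> powi (- k) * G) Q"
  proof -
    have "nat \<bar>- k + int l * int n\<bar> = nat \<bar>k - int l * int n\<bar>" for n by linarith
    then show ?thesis
      using has_sum_geometric_shifted[OF \<rho> l(1), of "- k"] l(3)
        has_sum_reindex_bij_betw[OF bijQ, of "\<lambda>i. \<rho> ^ nat \<bar>i\<bar>"]
      by (simp add: G_def)
  qed
  ultimately have "((\<lambda>i. \<rho> ^ nat \<bar>i\<bar>) has_sum \<rho> powi k * G + \<rho> powi (- k) * G) (P \<union> Q)"
    by (rule has_sum_Un_disjoint) (auto simp: P_def Q_def)
  then have g: "((\<lambda>i. \<rho> ^ nat \<bar>i\<bar> / m) has_sum (\<rho> powi k * G + \<rho> powi (- k) * G) / m) (P \<union> Q)"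
    by (rule has_sum_divide_const)
  have PQ: "{i. int l dvd i - k} - {k} = P \<union> Q" by (auto simp: P_def Q_def)
  have "(c has_sum (approx_coeff p l k - c k)) (P \<union> Q)"
    unfolding PQ[symmetric]
    by (rule has_sum_Diff[OF approx_coeff_has_sum[OF L l(1)]]) (auto intro!: has_sum_finiteI)
  then have 1: "cmod (approx_coeff p l k - c k) \<le> (\<rho> powi k * G + \<rho> powi (- k) * G) / m"
    using g decay by (rule norm_infsum_le)
  \<comment> \<open>As \<open>j\<close> is at least \<open>- l / 2\<close>, the total exponent
    \<open>j + l\<close> is at least \<open>l div 2\<close>.\<close>
  have pl: "\<rho> powi j * \<rho> ^ l \<le> \<rho> ^ (l div 2)" if "2 * \<bar>j\<bar> \<le> int l" for j
  proof -
    have "\<rho> powi j * \<rho> ^ l = \<rho> powi (j + int l)" using \<rho> by (simp add: power_int_add)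
    also have "\<dots> = \<rho> ^ nat (j + int l)" using that by (simp add: power_int_def)
    also have "\<dots> \<le> \<rho> ^ (l div 2)" using \<rho> that by (intro power_decreasing) auto
    finally show ?thesis .
  qed
  have l1: "1 - \<rho> ^ l > 0" using \<rho> l by (simp add: power_less_one_iff)
  have "\<rho> powi k * G + \<rho> powi (- k) * G = (\<rho> powi k * \<rho> ^ l + \<rho> powi (- k) * \<rho> ^ l) / (1 - \<rho> ^ l)"
    by (simp add: G_def add_divide_distrib)
  also have "\<dots> \<le> (\<rho> ^ (l div 2) + \<rho> ^ (l div 2)) / (1 - \<rho> ^ l)"
    using pl[of k] pl[of "- k"] l l1 by (intro divide_right_mono add_mono) auto
  finally have "(\<rho> powi k * G + \<rho> powi (- k) * G) / m \<le> (\<rho> ^ (l div 2) + \<rho> ^ (l div 2)) / (1 - \<rho> ^ l) / m"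
    using \<open>m > 0\<close> by (intro divide_right_mono) auto
  with 1 show ?thesis by (simp add: field_simps)
qed

subsection \<open>The inverse of the Toeplitz sections\<close>

text \<open>The action of the Toeplitz section of size \<open>N\<close>, on functions instead of
  vectors so that coefficient functions can be inserted directly. Size \<open>n\<close> serves the
  system for \<alpha>, size \<open>n + 1\<close> the one for \<beta>.\<close>

definition toep_mult :: "(int \<Rightarrow> complex) \<Rightarrow> nat \<Rightarrow> nat \<Rightarrow> (nat \<Rightarrow> complex) \<Rightarrow> nat \<Rightarrow> complex" where
  "toep_mult c \<kappa> N x i = (\<Sum>j<N. c (int i - int j - int \<kappa>) * x j)"

lemma sum_rotate3:
  "(\<Sum>m\<in>A. \<Sum>i\<in>B. \<Sum>j\<in>C. f m i j) = (\<Sum>i\<in>B. \<Sum>j\<in>C. \<Sum>m\<in>A. f m i j)"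
  by (subst sum.swap[of _ B A]) (intro sum.cong refl sum.swap)

context
  fixes c :: "int \<Rightarrow> complex" and p1 p2 :: "complex poly" and \<kappa> N :: nat
  assumes deg: "degree p1 = \<kappa>" "degree p1 < N" "degree p2 < N"
    and conv1: "\<And>k. k < 0 \<Longrightarrow> conv (poly_seq p1) c k = 0"
    and conv2: "\<And>k. k > - int \<kappa> \<Longrightarrow> conv (poly_seq p2) c k = 0"
    and conv12: "\<And>k. conv (poly_seq p2) (conv (poly_seq p1) c) k = (if k = 0 then 1 else 0)"
begin

text \<open>The left inverse comes from multiplying \<open>x / p = z\<^sup>-\<^sup>\<kappa> y + \<dots>\<close> by \<open>p1\<close> and by \<open>p2\<close> and cutting off the
  unwanted exponents. Since the weights are \<open>-1\<close>, \<open>0\<close> or \<open>1\<close>, the two terms together cost only one factor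
  \<open>\<parallel>p1\<parallel> \<parallel>p2\<parallel>\<close> in the norm.\<close>

definition toep_weight :: "nat \<Rightarrow> nat \<Rightarrow> nat \<Rightarrow> complex" where
  "toep_weight m i j = of_bool (\<kappa> \<le> i + m) - of_bool (N \<le> j + m)"

text \<open>With all weights equal to 1 this would be the coefficient of \<open>p1 * p2\<close> at
  \<open>s + \<kappa> - m\<close>.\<close>

definition toep_inv :: "nat \<Rightarrow> nat \<Rightarrow> complex" where
  "toep_inv s m = (\<Sum>i\<le>degree p1. \<Sum>j\<le>degree p2. coeff p1 i * coeff p2 j *
      (if m + i + j = s + \<kappa> then toep_weight m i j else 0))"

text \<open>Only \<open>m = s + \<kappa> - i - j\<close> contributes, and there the weight can be
  written in terms of \<open>s\<close> instead of \<open>m\<close>. If this index leaves the range,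
  the two indicators cancel.\<close>

lemma toep_weight_sum:
  assumes "i \<le> degree p1" "j \<le> degree p2" "s < N"
  shows "(\<Sum>m<N. (if m + i + j = s + \<kappa> then toep_weight m i j else 0) * c (int m - int t - int \<kappa>)) =
    (of_bool (j \<le> s) - of_bool (N + i \<le> s + \<kappa>)) * c (int s - int t - int i - int j)"
proof (cases "i + j \<le> s + \<kappa> \<and> s + \<kappa> - (i + j) < N")
  case True
  define m0 where "m0 = s + \<kappa> - (i + j)"
  have m0: "m0 + i + j = s + \<kappa>" "m0 < N" using True by (auto simp: m0_def)
  have "(\<Sum>m<N. (if m + i + j = s + \<kappa> then toep_weight m i j else 0) * c (int m - int t - int \<kappa>)) =
      (\<Sum>m<N. if m = m0 then toep_weight m0 i j * c (int m0 - int t - int \<kappa>) else 0)"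
    using m0(1) by (intro sum.cong) auto
  also have "\<dots> = toep_weight m0 i j * c (int m0 - int t - int \<kappa>)"
    using m0(2) by simp
  also have "toep_weight m0 i j = of_bool (j \<le> s) - of_bool (N + i \<le> s + \<kappa>)"
  proof -
    have "\<kappa> \<le> i + m0 \<longleftrightarrow> j \<le> s" "N \<le> j + m0 \<longleftrightarrow> N + i \<le> s + \<kappa>" using m0(1) by linarith+
    then show ?thesis by (simp add: toep_weight_def)
  qed
  also have "int m0 - int t - int \<kappa> = int s - int t - int i - int j" using m0(1) by linarith
  finally show ?thesis .
next
  case False
  have "(\<Sum>m<N. (if m + i + j = s + \<kappa> then toep_weight m i j else 0) * c (int m - int t - int \<kappa>)) = 0"
    using False by (intro sum.neutral) auto
  moreover have "of_bool (j \<le> s) = (of_bool (N + i \<le> s + \<kappa>) :: complex)"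
  proof -
    \<comment> \<open>A negative index makes both conditions fail, by
      \<open>i \<le> \<kappa>\<close> and \<open>j < N\<close>; an index of at least
      \<open>N\<close> makes both hold, by \<open>\<kappa> < N\<close>.\<close>
    have "j \<le> s \<longleftrightarrow> N + i \<le> s + \<kappa>" using False assms deg by linarith
    then show ?thesis by simp
  qed
  ultimately show ?thesis by simp
qed

text \<open>Summing over \<open>m\<close> leaves two indicators. The one in \<open>j\<close> yields
  the coefficient of \<open>p2 * (p1 / p) = 1\<close> at \<open>s - t\<close>; the one in
  \<open>i\<close> selects only vanishing coefficients of \<open>p2 / p\<close>.\<close>

lemma toep_left_inverse:
  assumes "s < N" "t < N"
  shows "(\<Sum>m<N. toep_inv s m * c (int m - int t - int \<kappa>)) = (if s = t then 1 else 0)"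
proof -
  have "(\<Sum>m<N. toep_inv s m * c (int m - int t - int \<kappa>)) =
    (\<Sum>m<N. \<Sum>i\<le>degree p1. \<Sum>j\<le>degree p2. coeff p1 i * coeff p2 j *
      ((if m + i + j = s + \<kappa> then toep_weight m i j else 0) * c (int m - int t - int \<kappa>)))"
    by (simp add: toep_inv_def sum_distrib_right mult.assoc)
  also have "\<dots> = (\<Sum>i\<le>degree p1. \<Sum>j\<le>degree p2. \<Sum>m<N. coeff p1 i * coeff p2 j *
      ((if m + i + j = s + \<kappa> then toep_weight m i j else 0) * c (int m - int t - int \<kappa>)))"
    by (rule sum_rotate3)
  also have "\<dots> = (\<Sum>i\<le>degree p1. \<Sum>j\<le>degree p2. coeff p1 i * coeff p2 j *
      ((of_bool (j \<le> s) - of_bool (N + i \<le> s + \<kappa>)) * c (int s - int t - int i - int j)))"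
    unfolding sum_distrib_left[symmetric]
    by (intro sum.cong refl) (simp add: toep_weight_sum assms)
  also have "\<dots> = (\<Sum>i\<le>degree p1. \<Sum>j\<le>degree p2. of_bool (j \<le> s) * (coeff p2 j * (coeff p1 i * c (int s - int t - int j - int i))))
      - (\<Sum>i\<le>degree p1. \<Sum>j\<le>degree p2. of_bool (N + i \<le> s + \<kappa>) * (coeff p1 i * (coeff p2 j * c (int s - int t - int i - int j))))"
    unfolding sum_subtractf[symmetric]
    by (intro sum.cong refl) (simp add: algebra_simps)
  also have "(\<Sum>i\<le>degree p1. \<Sum>j\<le>degree p2. of_bool (j \<le> s) * (coeff p2 j * (coeff p1 i * c (int s - int t - int j - int i))))
      = (\<Sum>j\<le>degree p2. of_bool (j \<le> s) * (coeff p2 j * conv (poly_seq p1) c (int s - int t - int j)))"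
    by (subst sum.swap) (simp add: conv_poly_seq sum_distrib_left)
  \<comment> \<open>For \<open>j > s\<close> the index \<open>s - t - j\<close> is negative, so
    \<open>conv1\<close> allows dropping the indicator.\<close>
  also have "\<dots> = (\<Sum>j\<le>degree p2. coeff p2 j * conv (poly_seq p1) c (int s - int t - int j))"
    by (intro sum.cong refl) (auto simp: conv1)
  also have "\<dots> = conv (poly_seq p2) (conv (poly_seq p1) c) (int s - int t)"
    by (simp only: conv_poly_seq[of p2])
  also have "\<dots> = (if s = t then 1 else 0)" by (simp add: conv12)
  also have "(\<Sum>i\<le>degree p1. \<Sum>j\<le>degree p2. of_bool (N + i \<le> s + \<kappa>) * (coeff p1 i * (coeff p2 j * c (int s - int t - int i - int j))))
     = (\<Sum>i\<le>degree p1. of_bool (N + i \<le> s + \<kappa>) * (coeff p1 i * conv (poly_seq p2) c (int s - int t - int i)))"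
    by (simp add: conv_poly_seq sum_distrib_left)
  \<comment> \<open>From \<open>N + i \<le> s + \<kappa>\<close> and \<open>t < N\<close> follows
    \<open>s - t - i > - \<kappa>\<close>, the range of \<open>conv2\<close>.\<close>
  also have "\<dots> = 0"
    using assms by (intro sum.neutral) (auto simp: conv2)
  finally show ?thesis by simp
qed

text \<open>For given \<open>m\<close>, \<open>i\<close>, \<open>j\<close> at most one row
  \<open>s\<close> satisfies the index condition, and the weights have modulus at most 1. Column
  sums control the operator 1-norm.\<close>

lemma toep_inv_column_bound: "(\<Sum>s<N. cmod (toep_inv s m)) \<le> coeff_norm p1 * coeff_norm p2"
proof -
  have w: "cmod (toep_weight m i j) \<le> 1" for i j by (simp add: toep_weight_def of_bool_def)
  have "(\<Sum>s<N. cmod (toep_inv s m)) \<le> (\<Sum>s<N. \<Sum>i\<le>degree p1. \<Sum>j\<le>degree p2.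
      cmod (coeff p1 i) * cmod (coeff p2 j) * (if m + i + j = s + \<kappa> then 1 else 0))"
    unfolding toep_inv_def
    by (intro sum_mono sum_norm_le) (auto simp: norm_mult intro!: mult_left_le w)
  also have "\<dots> = (\<Sum>i\<le>degree p1. \<Sum>j\<le>degree p2. \<Sum>s<N.
      cmod (coeff p1 i) * cmod (coeff p2 j) * (if m + i + j = s + \<kappa> then 1 else 0))"
    by (rule sum_rotate3)
  also have "\<dots> \<le> (\<Sum>i\<le>degree p1. \<Sum>j\<le>degree p2. cmod (coeff p1 i) * cmod (coeff p2 j))"
  proof (intro sum_mono)
    fix i j
    \<comment> \<open>Only an inequality: if \<open>m + i + j < \<kappa>\<close>, truncated
      subtraction selects \<open>s = 0\<close> on the right, while the left side is zero.\<close>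
    have "(\<Sum>s<N. if m + i + j = s + \<kappa> then 1 else 0 :: real) \<le> 
       (\<Sum>s<N. if s = m + i + j - \<kappa> then 1 else 0)"
      by (intro sum_mono) auto
    also have "\<dots> \<le> 1" by simp
    finally show "(\<Sum>s<N. cmod (coeff p1 i) * cmod (coeff p2 j) * (if m + i + j = s + \<kappa> then 1 else 0))
      \<le> cmod (coeff p1 i) * cmod (coeff p2 j)"
      unfolding sum_distrib_left[symmetric] by (intro mult_left_le) auto
  qed
  also have "\<dots> = coeff_norm p1 * coeff_norm p2"
    by (simp add: coeff_norm_def sum_product)
  finally show ?thesis .
qed

text \<open>\<open>x\<close> is recovered from its image by the left inverse, whose 1-norm is
  bounded by the column sums.\<close>

lemma toep_mult_lower_bound:
  "(\<Sum>i<N. cmod (x i)) \<le> coeff_norm p1 * coeff_norm p2 * (\<Sum>i<N. cmod (toep_mult c \<kappa> N x i))"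
proof -
  have x: "x s = (\<Sum>m<N. toep_inv s m * toep_mult c \<kappa> N x m)" if "s < N" for s
  proof -
    have "(\<Sum>m<N. toep_inv s m * toep_mult c \<kappa> N x m) =
        (\<Sum>m<N. \<Sum>t<N. toep_inv s m * c (int m - int t - int \<kappa>) * x t)"
      by (simp add: toep_mult_def sum_distrib_left mult.assoc)
    also have "\<dots> = (\<Sum>t<N. (\<Sum>m<N. toep_inv s m * c (int m - int t - int \<kappa>)) * x t)"
      by (subst sum.swap) (simp add: sum_distrib_right)
    also have "\<dots> = (\<Sum>t<N. if t = s then x s else 0)"
      using that by (intro sum.cong refl) (auto simp: toep_left_inverse)
    finally show ?thesis using that by simp
  qed
  have "(\<Sum>s<N. cmod (x s)) \<le> (\<Sum>s<N. \<Sum>m<N. cmod (toep_inv s m) * cmod (toep_mult c \<kappa> N x m))"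
    by (intro sum_mono, subst x) (auto simp: norm_mult intro!: sum_norm_le)
  also have "\<dots> = (\<Sum>m<N. (\<Sum>s<N. cmod (toep_inv s m)) * cmod (toep_mult c \<kappa> N x m))"
    by (subst sum.swap) (simp add: sum_distrib_right)
  also have "\<dots> \<le> (\<Sum>m<N. coeff_norm p1 * coeff_norm p2 * cmod (toep_mult c \<kappa> N x m))"
    by (intro sum_mono mult_right_mono toep_inv_column_bound) auto
  finally show ?thesis by (simp add: sum_distrib_left)
qed

end

subsection \<open>Perturbation and solvability\<close>

lemma toep_mult_diff_bound:
  assumes "\<And>i j. i < N \<Longrightarrow> j < N \<Longrightarrow> cmod (c' (int i - int j - int \<kappa>) - c (int i - int j - int \<kappa>)) \<le> \<eta>"
  shows "(\<Sum>i<N. cmod (toep_mult c' \<kappa> N x i - toep_mult c \<kappa> N x i)) \<le> real N * \<eta> * (\<Sum>i<N. cmod (x i))"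
proof -
  have "(\<Sum>i<N. cmod (toep_mult c' \<kappa> N x i - toep_mult c \<kappa> N x i)) \<le> (\<Sum>i<N. \<Sum>j<N. \<eta> * cmod (x j))"
    unfolding toep_mult_def sum_subtractf[symmetric] left_diff_distrib[symmetric]
    by (intro sum_mono sum_norm_le) (auto simp: norm_mult intro!: mult_right_mono assms)
  also have "\<dots> = real N * \<eta> * (\<Sum>i<N. cmod (x i))"
    by (simp add: sum_distrib_left[symmetric])
  finally show ?thesis .
qed

text \<open>The triangle inequality replaces \<open>c\<close> by \<open>c'\<close> at the cost of a
  perturbation term; multiplied by \<open>D\<close>, that term is at most \<open>q\<close> times the
  norm of \<open>x\<close> and is absorbed on the left.\<close>

lemma toep_mult_perturbed_lower_bound:
  assumes lower: "\<And>x. (\<Sum>i<N. cmod (x i)) \<le> D * (\<Sum>i<N. cmod (toep_mult c \<kappa> N x i))"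
    and \<eta>: "\<And>i j. i < N \<Longrightarrow> j < N \<Longrightarrow> cmod (c' (int i - int j - int \<kappa>) - c (int i - int j - int \<kappa>)) \<le> \<eta>"
    and "D * (real N * \<eta>) \<le> q" "0 \<le> D"
  shows "(1 - q) * (\<Sum>i<N. cmod (x i)) \<le> D * (\<Sum>i<N. cmod (toep_mult c' \<kappa> N x i))"
proof -
  have "(\<Sum>i<N. cmod (toep_mult c \<kappa> N x i)) \<le> (\<Sum>i<N. cmod (toep_mult c' \<kappa> N x i) + cmod (toep_mult c' \<kappa> N x i - toep_mult c \<kappa> N x i))"
    by (intro sum_mono) (metis norm_minus_commute norm_triangle_sub)
  also have "\<dots> \<le> (\<Sum>i<N. cmod (toep_mult c' \<kappa> N x i)) + real N * \<eta> * (\<Sum>i<N. cmod (x i))"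
    using toep_mult_diff_bound[of N c' \<kappa> c \<eta> x] \<eta> by (simp add: sum.distrib)
  finally have "D * (\<Sum>i<N. cmod (toep_mult c \<kappa> N x i)) \<le>
      D * ((\<Sum>i<N. cmod (toep_mult c' \<kappa> N x i)) + real N * \<eta> * (\<Sum>i<N. cmod (x i)))"
    using assms(4) by (rule mult_left_mono)
  also have "\<dots> = D * (\<Sum>i<N. cmod (toep_mult c' \<kappa> N x i)) + D * (real N * \<eta>) * (\<Sum>i<N. cmod (x i))"
    by (simp add: algebra_simps)
  also have "\<dots> \<le> D * (\<Sum>i<N. cmod (toep_mult c' \<kappa> N x i)) + q * (\<Sum>i<N. cmod (x i))"
    using assms(3) by (intro add_left_mono mult_right_mono sum_nonneg) auto
  finally show ?thesis using lower[of x] by (simp add: algebra_simps)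
qed

lemma ex1_mult_mat_vec:
  fixes A :: "'a :: field mat"
  assumes A: "A \<in> carrier_mat N N" and b: "b \<in> carrier_vec N"
    and inj: "\<And>v. v \<in> carrier_vec N \<Longrightarrow> A *\<^sub>v v = 0\<^sub>v N \<Longrightarrow> v = 0\<^sub>v N"
  shows "\<exists>!v. v \<in> carrier_vec N \<and> A *\<^sub>v v = b"
proof -
  have "det A \<noteq> 0" using det_0_iff_vec_prod_zero[OF A] inj by blast
  from det_non_zero_imp_unit[OF A this]
  obtain B where B: "B \<in> carrier_mat N N" "A * B = 1\<^sub>m N" "B * A = 1\<^sub>m N"
    by (auto simp: Units_def ring_mat_def)
  show ?thesis
  proof (rule ex1I[of _ "B *\<^sub>v b"])
    show "B *\<^sub>v b \<in> carrier_vec N \<and> A *\<^sub>v (B *\<^sub>v b) = b"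
      using A B b by (simp add: assoc_mult_mat_vec[symmetric, of _ N N _ N])
    fix v assume v: "v \<in> carrier_vec N \<and> A *\<^sub>v v = b"
    have "B *\<^sub>v (A *\<^sub>v v) = v"
      using A B v[THEN conjunct1] by (simp add: assoc_mult_mat_vec[symmetric, of _ N N _ N])
    then show "v = B *\<^sub>v b" using v by simp
  qed
qed

text \<open>Compactness provides a point \<open>w\<close> where the modulus is minimal; its value
  there is positive and bounds the infimum from below.\<close>

lemma min_modulus_annulus:
  assumes "0 < r" "r < 1" "1 < R" and nz: "\<forall>z\<in>annulus r R. poly p z \<noteq> 0"
  shows "min_modulus p (annulus r R) > 0"
    and "z \<in> annulus r R \<Longrightarrow> min_modulus p (annulus r R) \<le> cmod (poly p z)"
proof -
  have eq: "annulus r R = cball 0 R - ball 0 r" by (auto simp: annulus_def)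
  have cpt: "compact (annulus r R)" unfolding eq by (intro compact_diff) auto
  have ne: "annulus r R \<noteq> {}" using assms by (auto simp: annulus_def intro!: exI[of _ 1])
  obtain w where w: "w \<in> annulus r R" "\<forall>z\<in>annulus r R. cmod (poly p w) \<le> cmod (poly p z)"
    using continuous_attains_inf[OF cpt ne, of "\<lambda>z. cmod (poly p z)"]
    by (fastforce intro: continuous_intros)
  have "cmod (poly p w) \<le> min_modulus p (annulus r R)"
    unfolding min_modulus_def using ne w(2) by (intro cINF_greatest) auto
  then show "min_modulus p (annulus r R) > 0"
    using nz w(1) by (meson order_less_le_trans zero_less_norm_iff)
  show "min_modulus p (annulus r R) \<le> cmod (poly p z)" if "z \<in> annulus r R"
    unfolding min_modulus_def using that by (intro cINF_lower bdd_belowI2[of _ 0]) auto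
qed

text \<open>A summation range independent of the degree is convenient for differences of
  polynomials, where leading terms may cancel.\<close>

lemma coeff_norm_eq_sum:
  assumes "\<And>i. i \<ge> N \<Longrightarrow> coeff f i = 0"
  shows "coeff_norm f = (\<Sum>i<N. cmod (coeff f i))"
proof -
  have "coeff_norm f = (\<Sum>i\<in>{..degree f} \<inter> {..<N}. cmod (coeff f i))"
    unfolding coeff_norm_def using assms by (intro sum.mono_neutral_right) (auto simp: not_le[symmetric])
  also have "\<dots> = (\<Sum>i<N. cmod (coeff f i))"
    by (intro sum.mono_neutral_left) (auto intro: le_degree)
  finally show ?thesis .
qed

lemma coeff_norm_ge_1:
  assumes "lead_coeff f = 1"
  shows "coeff_norm f \<ge> 1"
proof -
  have "cmod (coeff f (degree f)) \<le> coeff_norm f"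
    unfolding coeff_norm_def by (intro member_le_sum) auto
  then show ?thesis using assms by simp
qed

text \<open>The last \<open>\<kappa>\<close> of the \<open>n\<close> unknowns in \<alpha> form the
  approximate first factor; this moves between the block and the full range.\<close>

lemma sum_top_block:
  fixes G :: "nat \<Rightarrow> 'a::comm_monoid_add"
  assumes "k \<le> n"
  shows "(\<Sum>j<n. if n \<le> j + k then G j else 0) = (\<Sum>t<k. G (n - k + t))"
proof -
  have im: "(\<lambda>t. n - k + t) ` {..<k} = {n - k..<n}"
    using image_add_atLeastLessThan[of "n - k" 0 k] assms by (simp add: lessThan_atLeast0)
  have "(\<Sum>t<k. G (n - k + t)) = sum G ((\<lambda>t. n - k + t) ` {..<k})"
    by (subst sum.reindex) auto
  also have "\<dots> = (\<Sum>j<n. if n \<le> j + k then G j else 0)"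
    unfolding im by (intro sum.mono_neutral_cong_left) auto
  finally show ?thesis by simp
qed

lemma toeplitz_mult_vec:
  assumes "v \<in> carrier_vec N"
  shows "mat N N (\<lambda>(i, j). c (- int \<kappa> + int i - int j)) *\<^sub>v v = vec N (toep_mult c \<kappa> N (\<lambda>j. v $ j))"
proof (rule eq_vecI)
  fix i assume "i < dim_vec (vec N (toep_mult c \<kappa> N (\<lambda>j. v $ j)))"
  then have "i < N" by simp
  then have "(mat N N (\<lambda>(i, j). c (- int \<kappa> + int i - int j)) *\<^sub>v v) $ i =
      (\<Sum>j<N. c (- int \<kappa> + int i - int j) * v $ j)"
    using assms by (simp add: scalar_prod_def lessThan_atLeast0)
  also have "\<dots> = toep_mult c \<kappa> N (\<lambda>j. v $ j) i"
    unfolding toep_mult_def by (intro sum.cong arg_cong2[of _ _ _ _ "(*)"] arg_cong[of _ _ c]) auto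
  finally show "(mat N N (\<lambda>(i, j). c (- int \<kappa> + int i - int j)) *\<^sub>v v) $ i =
      vec N (toep_mult c \<kappa> N (\<lambda>j. v $ j)) $ i"
    using \<open>i < N\<close> by simp
qed simp

lemma solves_beta_eq:
  "solves_beta c n \<kappa> \<beta> \<longleftrightarrow> \<beta> \<in> carrier_vec (n + 1) \<and>
    mat (n + 1) (n + 1) (\<lambda>(i, j). c (- int \<kappa> + int i - int j)) *\<^sub>v \<beta> = unit_vec (n + 1) 0"
proof -
  have "nat (int n - int \<kappa> - (- int \<kappa>) + 1) = n + 1" "nat (- int \<kappa> - (- int n - int \<kappa>) + 1) = n + 1"
    by auto
  then show ?thesis by (simp only: solves_beta_def toeplitz_def)
qed

lemma solves_alpha_eq:
  "solves_alpha c n \<kappa> \<alpha> \<longleftrightarrow> \<alpha> \<in> carrier_vec n \<and>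
    mat n n (\<lambda>(i, j). c (- int \<kappa> + int i - int j)) *\<^sub>v \<alpha> = - vec n (\<lambda>i. c (- int n - int \<kappa> + int i))"
proof -
  have "nat (int n - int \<kappa> - 1 - (- int \<kappa>) + 1) = n" "nat (- int \<kappa> - (- int n - int \<kappa> + 1) + 1) = n"
    by auto
  then show ?thesis by (simp only: solves_alpha_def toeplitz_def)
qed

text \<open>As \<open>1 - q > 0\<close>, the lower bound leaves only the zero vector in the
  kernel.\<close>

lemma toeplitz_ex1:
  assumes lower: "\<And>x. (1 - q) * (\<Sum>i<N. cmod (x i)) \<le> D * (\<Sum>i<N. cmod (toep_mult c \<kappa> N x i))"
    and "q < 1" and b: "b \<in> carrier_vec N"
  shows "\<exists>!v. v \<in> carrier_vec N \<and> mat N N (\<lambda>(i, j). c (- int \<kappa> + int i - int j)) *\<^sub>v v = b"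
proof (rule ex1_mult_mat_vec[OF _ b])
  fix v :: "complex vec"
  assume v: "v \<in> carrier_vec N" and z: "mat N N (\<lambda>(i, j). c (- int \<kappa> + int i - int j)) *\<^sub>v v = 0\<^sub>v N"
  have "toep_mult c \<kappa> N (\<lambda>j. v $ j) i = 0" if "i < N" for i
    using arg_cong[OF z[unfolded toeplitz_mult_vec[OF v]], of "\<lambda>w. w $ i"] that by simp
  with lower[of "\<lambda>j. v $ j"] have "(1 - q) * (\<Sum>i<N. cmod (v $ i)) \<le> 0" by simp
  then have "(\<Sum>i<N. cmod (v $ i)) \<le> 0" using assms(2) by (simp add: mult_le_0_iff)
  then have "(\<Sum>i<N. cmod (v $ i)) = 0" by (intro antisym sum_nonneg) auto
  then have "\<forall>i<N. v $ i = 0" by (simp add: sum_nonneg_eq_0_iff)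
  then show "v = 0\<^sub>v N" using v by (intro eq_vecI) auto
qed simp

lemma toep_mult_diff:
  "toep_mult c \<kappa> N (\<lambda>j. x j - y j) i = toep_mult c \<kappa> N x i - toep_mult c \<kappa> N y i"
  by (simp add: toep_mult_def right_diff_distrib sum_subtractf)

text \<open>For the exact \<open>c\<close> these are the coefficients of \<open>p2 / p\<close> from
  index \<open>- \<kappa>\<close> upwards, that is 1, 0, 0 and so on, so \<open>p2\<close> solves
  the exact system for \<beta>.\<close>

lemma toep_mult_coeffs:
  assumes "degree p2 < N"
  shows "toep_mult c \<kappa> N (coeff p2) i = conv (poly_seq p2) c (int i - int \<kappa>)"
proof -
  have "conv (poly_seq p2) c (int i - int \<kappa>) = (\<Sum>j<N. coeff p2 j * c (int i - int \<kappa> - int j))"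
    unfolding conv_poly_seq using assms by (intro sum.mono_neutral_left) (auto simp: coeff_eq_0)
  also have "\<dots> = toep_mult c \<kappa> N (coeff p2) i"
    unfolding toep_mult_def by (intro sum.cong) (auto simp: algebra_simps)
  finally show ?thesis by simp
qed

text \<open>The lower coefficients of \<open>p1\<close> fill the last \<open>\<kappa>\<close>
  places. The leading coefficient 1 has no place in the vector, so its term
  \<open>c (i - n - \<kappa>)\<close> is subtracted; for the exact \<open>c\<close> the convolution
  vanishes at \<open>i - n < 0\<close>.\<close>

lemma toep_mult_top_coeffs:
  assumes "degree p1 = \<kappa>" "lead_coeff p1 = 1" "\<kappa> \<le> n"
  shows "toep_mult c \<kappa> n (\<lambda>j. if n \<le> j + \<kappa> then coeff p1 (j + \<kappa> - n) else 0) i =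
    conv (poly_seq p1) c (int i - int n) - c (int i - int n - int \<kappa>)"
proof -
  have "toep_mult c \<kappa> n (\<lambda>j. if n \<le> j + \<kappa> then coeff p1 (j + \<kappa> - n) else 0) i =
      (\<Sum>j<n. if n \<le> j + \<kappa> then c (int i - int j - int \<kappa>) * coeff p1 (j + \<kappa> - n) else 0)"
    unfolding toep_mult_def by (intro sum.cong) auto
  also have "\<dots> = (\<Sum>t<\<kappa>. coeff p1 t * c (int i - int n - int t))"
    unfolding sum_top_block[OF assms(3)] using assms(3)
    by (intro sum.cong) (auto simp: of_nat_diff algebra_simps)
  also have "\<dots> = conv (poly_seq p1) c (int i - int n) - c (int i - int n - int \<kappa>)"
    unfolding conv_poly_seq using assms(1,2) by (simp add: lessThan_Suc_atMost[symmetric])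
  finally show ?thesis .
qed

lemma coeff_approx_p1:
  "coeff (approx_p1 n \<kappa> \<alpha>) i = (if i < \<kappa> then \<alpha> $ (n - \<kappa> + i) else if i = \<kappa> then 1 else 0)"
  by (simp add: approx_p1_def coeff_sum)

lemma coeff_approx_p2:
  "coeff (approx_p2 \<nu> \<kappa> \<beta>) i = (if i \<le> \<nu> - \<kappa> then \<beta> $ i else 0)"
  by (simp add: approx_p2_def coeff_sum)

subsection \<open>The error estimates\<close>

theorem theorem5p5:
  fixes p p1 p2 :: "complex poly"
    and r R \<rho> mK \<delta>0 q :: real
    and \<nu> \<kappa> n0 n l :: nat
  assumes "lead_coeff p = 1" and "degree p = \<nu>" and "\<nu> > 1" and "poly p 0 \<noteq> 0"
    and "0 < r" and "r < 1" and "1 < R"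
    and "\<forall>z \<in> annulus r R. poly p z \<noteq> 0"
    and "\<kappa> = zeros_in_unit_disc p" and "0 < \<kappa>" and "\<kappa> < \<nu>"
    and "n0 = max \<kappa> (\<nu> - \<kappa>)"
    and "p = p1 * p2"
    and "lead_coeff p1 = 1" and "lead_coeff p2 = 1"
    and "degree p1 = \<kappa>" and "degree p2 = \<nu> - \<kappa>"
    and "\<forall>z. poly p1 z = 0 \<longrightarrow> cmod z < r"
    and "\<forall>z. poly p2 z = 0 \<longrightarrow> cmod z > R"
    and "mK = min_modulus p (annulus r R)"
    and "\<rho> = max r (1 / R)"
    and "coeff_norm p1 * coeff_norm p2 \<le> \<delta>0 * coeff_norm p"
    and "1 \<le> \<delta>0"
    and "\<delta>0 \<le> exp (2 * catalan_const / pi) ^ \<nu> * sqrt ((real \<kappa> + 1) * (real \<nu> - real \<kappa> + 1))"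
    and "0 < q" and "q < 1"
    and "n \<ge> n0 + 1"
    and "even l" and "l \<ge> 2 * (n + \<kappa>)"
    and "\<rho> ^ (l div 2) / (1 - \<rho> ^ l) < q * mK / ((4 * real n + 2) * \<delta>0 * coeff_norm p)"
  shows "(\<exists>!\<alpha>. solves_alpha (approx_coeff p l) n \<kappa> \<alpha>) \<and>
    (\<exists>!\<beta>. solves_beta (approx_coeff p l) n \<kappa> \<beta>) \<and>
    (\<forall>\<alpha> \<beta>. solves_alpha (approx_coeff p l) n \<kappa> \<alpha> \<longrightarrow> solves_beta (approx_coeff p l) n \<kappa> \<beta> \<longrightarrow>
      coeff_norm (p1 - approx_p1 n \<kappa> \<alpha>)
        < (4 * real n - 2) * \<delta>0 * coeff_norm p / ((1 - q) * mK)
          * (\<delta>0 * (1 + \<rho>) * coeff_norm p / ((1 - q) * (1 - \<rho>) * mK) + 1)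
          * (\<rho> ^ (l div 2) / (1 - \<rho> ^ l)) \<and>
      coeff_norm (p2 - approx_p2 \<nu> \<kappa> \<beta>)
        < (4 * real n + 2) * \<delta>0\<^sup>2 * (coeff_norm p)\<^sup>2 / ((1 - q) * mK)
          * (\<rho> ^ (l div 2) / (1 - \<rho> ^ l)))"
proof -

  \<comment> \<open>Constants and the smallness condition\<close>
  define D where "D = \<delta>0 * coeff_norm p"
  define E where "E = \<rho> ^ (l div 2) / (1 - \<rho> ^ l)"
  define \<eta> where "\<eta> = 2 / mK * E"
  define c' where "c' = approx_coeff p l"
  have n: "\<kappa> < n" "\<nu> - \<kappa> < n" "2 \<le> n" "l > 0" using assms(10,11,12,27,29) by auto
  have \<rho>: "0 < \<rho>" "\<rho> < 1" using assms(5-7,21) by auto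
  have mK: "mK > 0" and mKle: "\<And>z. z \<in> annulus r R \<Longrightarrow> mK \<le> cmod (poly p z)"
    unfolding assms(20) using min_modulus_annulus[OF assms(5-8)] by auto
  have l1: "\<rho> ^ l < 1" using \<rho> n by (simp add: power_less_one_iff)
  have E: "E > 0" unfolding E_def using \<rho> l1 by simp
  have \<eta>: "\<eta> > 0" unfolding \<eta>_def using E mK by simp
  have P1: "coeff_norm p1 \<ge> 1" and P2: "coeff_norm p2 \<ge> 1"
    using coeff_norm_ge_1 assms(14,15) by auto
  have PD: "coeff_norm p1 * coeff_norm p2 \<le> D" using assms(22) by (simp add: D_def)
  have "coeff_norm p2 \<le> coeff_norm p1 * coeff_norm p2" using P1 P2 by simp
  with PD have P2D: "coeff_norm p2 \<le> D" by linarith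
  with P2 have D: "D > 0" by linarith
  have small: "(4 * real n + 2) * D * E < q * mK"
  proof -
    have "E < q * mK / ((4 * real n + 2) * D)"
      using assms(30) by (simp add: E_def D_def mult.assoc)
    moreover have "(4 * real n + 2) * D > 0" using D by simp
    ultimately have "E * ((4 * real n + 2) * D) < q * mK" using pos_less_divide_eq by blast
    then show ?thesis by (simp add: mult.commute)
  qed

  \<comment> \<open>Exact Laurent coefficients and their approximation\<close>
  obtain c where
    Lc: "\<And>s. r < s \<Longrightarrow> s < R \<Longrightarrow> laurent_on c s (\<lambda>z. 1 / poly p z)" and
    cv1: "\<And>k. k < 0 \<Longrightarrow> conv (poly_seq p1) c k = 0" and
    cv2: "\<And>k. k > - int \<kappa> \<Longrightarrow> conv (poly_seq p2) c k = 0" and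
    cv20: "conv (poly_seq p2) c (- int \<kappa>) = 1" and
    cv12: "\<And>k. conv (poly_seq p2) (conv (poly_seq p1) c) k = (if k = 0 then 1 else 0)"
    by (rule laurent_coeffs_inverse_factorization[OF assms(5-7,14,13,16,18,19)]) (rule that)
  have decay: "cmod (c k) \<le> \<rho> ^ nat \<bar>k\<bar> / mK" for k
    unfolding assms(21) by (rule laurent_coeff_decay[OF assms(5-7) mK Lc mKle])
  \<comment> \<open>The systems involve the indices \<open>i - j - \<kappa>\<close> with
    \<open>i\<close> and \<open>j\<close> at most \<open>n\<close>, and
    \<open>i - n - \<kappa>\<close> with \<open>i < n\<close>; all have modulus at most
    \<open>n + \<kappa>\<close>, hence at most \<open>l / 2\<close>.\<close>
  have err: "cmod (c' k - c k) \<le> \<eta>" if "\<bar>k\<bar> \<le> int n + int \<kappa>" for k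
    unfolding c'_def \<eta>_def E_def using assms(28,29) that n(4)
    by (intro approx_coeff_error[OF Lc decay \<rho> mK]) (use assms(6,7) in auto)

  \<comment> \<open>Lower bounds for the exact and the perturbed systems\<close>
  have low: "(\<Sum>i<N. cmod (x i)) \<le> D * (\<Sum>i<N. cmod (toep_mult c \<kappa> N x i))"
    if "N > \<kappa>" "N > \<nu> - \<kappa>" for N x
  proof -
    have "(\<Sum>i<N. cmod (x i)) \<le> coeff_norm p1 * coeff_norm p2 * (\<Sum>i<N. cmod (toep_mult c \<kappa> N x i))"
      using that assms(16,17) cv1 cv2 cv12 by (intro toep_mult_lower_bound) auto
    also have "\<dots> \<le> D * (\<Sum>i<N. cmod (toep_mult c \<kappa> N x i))"
      by (intro mult_right_mono PD sum_nonneg) auto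
    finally show ?thesis .
  qed
  have err': "cmod (c' (int i - int j - int \<kappa>) - c (int i - int j - int \<kappa>)) \<le> \<eta>"
    if "i < N" "j < N" "N \<le> n + 1" for i j N
    using that by (intro err) auto
  have diff: "(\<Sum>i<N. cmod (toep_mult c' \<kappa> N x i - toep_mult c \<kappa> N x i)) \<le> real N * \<eta> * (\<Sum>i<N. cmod (x i))"
    if "N \<le> n + 1" for N x
    using err' that by (intro toep_mult_diff_bound) auto
  have low': "(1 - q) * (\<Sum>i<N. cmod (x i)) \<le> D * (\<Sum>i<N. cmod (toep_mult c' \<kappa> N x i))"
    if "N > \<kappa>" "N > \<nu> - \<kappa>" "N \<le> n + 1" for N x
  proof (rule toep_mult_perturbed_lower_bound[where \<eta> = \<eta>, OF low[OF that(1,2)] err'[OF _ _ that(3)]])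
    have "D * (real N * \<eta>) = 2 * real N * D * E / mK" by (simp add: \<eta>_def)
    \<comment> \<open>\<open>N \<le> n + 1\<close> gives \<open>2 * N \<le> 2 * n + 2\<close>, which
      is at most \<open>4 * n + 2\<close>.\<close>
    also have "\<dots> \<le> (4 * real n + 2) * D * E / mK"
      using that(3) D E mK by (intro divide_right_mono mult_right_mono) auto
    also have "\<dots> \<le> q" using small mK by (simp add: field_simps)
    finally show "D * (real N * \<eta>) \<le> q" .
  qed (use D in auto)

  \<comment> \<open>Unique solvability of the perturbed systems\<close>
  have ex_alpha: "\<exists>!\<alpha>. solves_alpha c' n \<kappa> \<alpha>"
    unfolding solves_alpha_eq using n assms(26)
    by (intro toeplitz_ex1[OF low']) auto
  have ex_beta: "\<exists>!\<beta>. solves_beta c' n \<kappa> \<beta>"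
    unfolding solves_beta_eq using n assms(26)
    by (intro toeplitz_ex1[OF low']) auto

  \<comment> \<open>Error of the second factor\<close>
  have est_beta: "coeff_norm (p2 - approx_p2 \<nu> \<kappa> \<beta>)
        < (4 * real n + 2) * \<delta>0\<^sup>2 * (coeff_norm p)\<^sup>2 / ((1 - q) * mK) * E"
    if \<beta>: "solves_beta c' n \<kappa> \<beta>" for \<beta>
  proof -
    have \<beta>c: "\<beta> \<in> carrier_vec (n + 1)"
      using \<beta> by (simp add: solves_beta_eq)
    have \<beta>e: "vec (n + 1) (toep_mult c' \<kappa> (n + 1) (\<lambda>j. \<beta> $ j)) = unit_vec (n + 1) 0"
      using \<beta> unfolding solves_beta_eq toeplitz_mult_vec[OF \<beta>c, of c' \<kappa>] by blast
    define d where "d j = coeff p2 j - \<beta> $ j" for j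
    \<comment> \<open>\<beta> solves the perturbed system and \<open>p2\<close> the exact one with
      the same right-hand side, so the residual of \<open>d\<close> is the matrix perturbation
      applied to \<open>p2\<close>.\<close>
    have "toep_mult c' \<kappa> (n + 1) d i = toep_mult c' \<kappa> (n + 1) (coeff p2) i - toep_mult c \<kappa> (n + 1) (coeff p2) i"
      if "i < n + 1" for i
    proof -
      have "toep_mult c' \<kappa> (n + 1) (\<lambda>j. \<beta> $ j) i = (if i = 0 then 1 else 0)"
        using arg_cong[OF \<beta>e, of "\<lambda>w. w $ i"] that by (simp add: unit_vec_def)
      also have "\<dots> = toep_mult c \<kappa> (n + 1) (coeff p2) i"
        using n assms(17) by (subst toep_mult_coeffs) (auto simp: cv2 cv20)
      finally show ?thesis unfolding d_def[abs_def] toep_mult_diff by simp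
    qed
    then have "(\<Sum>i<n + 1. cmod (toep_mult c' \<kappa> (n + 1) d i)) \<le> real (n + 1) * \<eta> * (\<Sum>i<n + 1. cmod (coeff p2 i))"
      using diff[of "n + 1" "coeff p2"] by simp
    also have "(\<Sum>i<n + 1. cmod (coeff p2 i)) = coeff_norm p2"
      using n assms(17) by (intro coeff_norm_eq_sum[symmetric]) (simp add: coeff_eq_0)
    \<comment> \<open>Bounding the norm of \<open>p2\<close> by \<open>D\<close> produces the second
      factor \<open>\<delta>0 * coeff_norm p\<close> of the estimate.\<close>
    also have "real (n + 1) * \<eta> * coeff_norm p2 \<le> real (n + 1) * \<eta> * D"
      using P2D \<eta> by (intro mult_left_mono) auto
    finally have "D * (\<Sum>i<n + 1. cmod (toep_mult c' \<kappa> (n + 1) d i)) \<le> D * (real (n + 1) * \<eta> * D)"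
      using D by (intro mult_left_mono) auto
    moreover have "(1 - q) * (\<Sum>i<n + 1. cmod (d i)) \<le> D * (\<Sum>i<n + 1. cmod (toep_mult c' \<kappa> (n + 1) d i))"
      using n by (intro low') auto
    moreover have "D * (real (n + 1) * \<eta> * D) = (2 * real n + 2) * (D\<^sup>2 * E / mK)"
      by (simp add: \<eta>_def power2_eq_square field_simps)
    ultimately have "(1 - q) * (\<Sum>i<n + 1. cmod (d i)) \<le> (2 * real n + 2) * (D\<^sup>2 * E / mK)"
      by linarith
    \<comment> \<open>The strict inequality arises here, from \<open>n > 0\<close>.\<close>
    also have "\<dots> < (4 * real n + 2) * (D\<^sup>2 * E / mK)"
      using n D E mK by (intro mult_strict_right_mono) auto
    finally have "(\<Sum>i<n + 1. cmod (d i)) < (4 * real n + 2) * (D\<^sup>2 * E / mK) / (1 - q)"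
      using assms(26) by (simp only: pos_less_divide_eq mult.commute[of _ "1 - q"] diff_gt_0_iff_gt)
    moreover have "coeff_norm (p2 - approx_p2 \<nu> \<kappa> \<beta>) \<le> (\<Sum>i<n + 1. cmod (d i))"
    proof -
      have "coeff_norm (p2 - approx_p2 \<nu> \<kappa> \<beta>) = (\<Sum>i<n + 1. cmod (coeff (p2 - approx_p2 \<nu> \<kappa> \<beta>) i))"
        using n assms(17) by (intro coeff_norm_eq_sum) (auto simp: coeff_approx_p2 coeff_eq_0)
      \<comment> \<open>Entries of \<beta> beyond \<open>\<nu> - \<kappa>\<close> are cut off by
        \<open>approx_p2\<close> and only enlarge the right-hand side.\<close>
      also have "\<dots> \<le> (\<Sum>i<n + 1. cmod (d i))"
        using assms(17) by (intro sum_mono) (auto simp: coeff_approx_p2 d_def coeff_eq_0)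
      finally show ?thesis .
    qed
    ultimately show ?thesis
      by (simp add: D_def power_mult_distrib mult.assoc mult.commute[of mK])
  qed

  \<comment> \<open>Error of the first factor\<close>
  have est_alpha: "coeff_norm (p1 - approx_p1 n \<kappa> \<alpha>)
        < (4 * real n - 2) * \<delta>0 * coeff_norm p / ((1 - q) * mK)
          * (\<delta>0 * (1 + \<rho>) * coeff_norm p / ((1 - q) * (1 - \<rho>) * mK) + 1) * E"
    if \<alpha>: "solves_alpha c' n \<kappa> \<alpha>" for \<alpha>
  proof -
    have \<alpha>c: "\<alpha> \<in> carrier_vec n"
      using \<alpha> by (simp add: solves_alpha_eq)
    have \<alpha>e: "vec n (toep_mult c' \<kappa> n (\<lambda>j. \<alpha> $ j)) = - vec n (\<lambda>i. c' (- int n - int \<kappa> + int i))"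
      using \<alpha> unfolding solves_alpha_eq toeplitz_mult_vec[OF \<alpha>c, of c' \<kappa>] by blast
    \<comment> \<open>\<open>a\<close> is the exact solution: the coefficients of \<open>p1\<close>
      below the leading one in the last \<open>\<kappa>\<close> places, zeros before them.\<close>
    define a where "a j = (if n \<le> j + \<kappa> then coeff p1 (j + \<kappa> - n) else 0)" for j
    define d where "d j = a j - \<alpha> $ j" for j
    \<comment> \<open>The bracket of the claimed bound; it enters as an upper bound for the norm of
      \<open>p1\<close>.\<close>
    define B where "B = D * (1 + \<rho>) / ((1 - q) * (1 - \<rho>) * mK) + 1"
    have Ta: "toep_mult c \<kappa> n a i = - c (int i - int n - int \<kappa>)" if "i < n" for i
      unfolding a_def[abs_def] using toep_mult_top_coeffs[OF assms(16,14), of n c i] n that cv1 by simp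
    have na: "(\<Sum>j<n. cmod (a j)) + 1 = coeff_norm p1"
    proof -
      have "(\<Sum>j<n. cmod (a j)) = (\<Sum>j<n. if n \<le> j + \<kappa> then cmod (coeff p1 (j + \<kappa> - n)) else 0)"
        by (intro sum.cong) (auto simp: a_def)
      also have "\<dots> = (\<Sum>t<\<kappa>. cmod (coeff p1 t))"
        using n by (subst sum_top_block) auto
      finally show ?thesis
        using assms(14,16) by (simp add: coeff_norm_def lessThan_Suc_atMost[symmetric])
    qed
    have "(\<Sum>i<n. cmod (toep_mult c \<kappa> n a i)) \<le> 1 / ((1 - \<rho>) * mK)"
    proof -
      have "(\<Sum>i<n. cmod (toep_mult c \<kappa> n a i)) \<le> (\<Sum>i<n. \<rho> ^ (n - Suc i) / mK)"
      proof (rule sum_mono)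
        fix i assume "i \<in> {..<n}"
        then have "cmod (toep_mult c \<kappa> n a i) \<le> \<rho> ^ nat \<bar>int i - int n - int \<kappa>\<bar> / mK"
          using decay[of "int i - int n - int \<kappa>"] by (simp only: lessThan_iff Ta norm_minus_cancel)
        \<comment> \<open>The true exponent \<open>n + \<kappa> - i\<close> is lowered to
          \<open>n - Suc i\<close>, so that reversing the sum gives a plain geometric one.\<close>
        also have "\<dots> \<le> \<rho> ^ (n - Suc i) / mK"
          using \<rho> mK \<open>i \<in> {..<n}\<close> by (intro divide_right_mono power_decreasing) auto
        finally show "cmod (toep_mult c \<kappa> n a i) \<le> \<rho> ^ (n - Suc i) / mK" .
      qed
      also have "\<dots> = (\<Sum>i<n. \<rho> ^ i) / mK"
        unfolding sum_divide_distrib[symmetric] by (subst sum.nat_diff_reindex) simp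
      also have "\<dots> = (1 - \<rho> ^ n) / (1 - \<rho>) / mK"
        using \<rho> by (simp add: sum_gp_strict)
      also have "\<dots> \<le> 1 / (1 - \<rho>) / mK"
        using \<rho> mK by (intro divide_right_mono) auto
      finally show ?thesis by simp
    qed
    then have "D * (\<Sum>i<n. cmod (toep_mult c \<kappa> n a i)) \<le> D * (1 / ((1 - \<rho>) * mK))"
      using D by (intro mult_left_mono) auto
    moreover have "(\<Sum>j<n. cmod (a j)) \<le> D * (\<Sum>i<n. cmod (toep_mult c \<kappa> n a i))"
      using n by (intro low) auto
    ultimately have "(\<Sum>j<n. cmod (a j)) \<le> D / ((1 - \<rho>) * mK)" by simp
    also have "\<dots> \<le> D * (1 + \<rho>) / ((1 - q) * (1 - \<rho>) * mK)"
    proof (rule frac_le)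
      show "D \<le> D * (1 + \<rho>)" using D \<rho> by (simp add: algebra_simps)
      show "(1 - q) * (1 - \<rho>) * mK \<le> (1 - \<rho>) * mK"
        using assms(25,26) \<rho> mK by (intro mult_right_mono) auto
    qed (use assms(25,26) D \<rho> mK in auto)
    finally have p1B: "coeff_norm p1 \<le> B" unfolding na[symmetric] B_def by simp
    \<comment> \<open>Here the right-hand side is perturbed too, so its error joins the matrix
      perturbation applied to \<open>a\<close>.\<close>
    have Td: "toep_mult c' \<kappa> n d i = (toep_mult c' \<kappa> n a i - toep_mult c \<kappa> n a i) +
        (c' (int i - int n - int \<kappa>) - c (int i - int n - int \<kappa>))" if "i < n" for i
    proof -
      have "toep_mult c' \<kappa> n (\<lambda>j. \<alpha> $ j) i = - c' (int i - int n - int \<kappa>)"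
        using arg_cong[OF \<alpha>e, of "\<lambda>w. w $ i"] that by (simp add: algebra_simps)
      then show ?thesis unfolding d_def[abs_def] toep_mult_diff Ta[OF that] by simp
    qed
    have "(\<Sum>i<n. cmod (toep_mult c' \<kappa> n d i)) \<le>
        (\<Sum>i<n. cmod (toep_mult c' \<kappa> n a i - toep_mult c \<kappa> n a i) + \<eta>)"
      using err by (intro sum_mono) (auto simp: Td intro!: norm_triangle_le)
    also have "\<dots> \<le> real n * \<eta> * (\<Sum>j<n. cmod (a j)) + real n * \<eta>"
      using diff[of n a] by (simp add: sum.distrib)
    \<comment> \<open>The error of the right-hand side counts like the missing leading coefficient 1
      and completes the norm of \<open>a\<close> to that of \<open>p1\<close>.\<close>
    also have "\<dots> = real n * \<eta> * coeff_norm p1"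
      unfolding na[symmetric] by (simp add: algebra_simps)
    also have "\<dots> \<le> real n * \<eta> * B"
      using p1B \<eta> by (intro mult_left_mono) auto
    finally have "D * (\<Sum>i<n. cmod (toep_mult c' \<kappa> n d i)) \<le> D * (real n * \<eta> * B)"
      using D by (intro mult_left_mono) auto
    moreover have "(1 - q) * (\<Sum>i<n. cmod (d i)) \<le> D * (\<Sum>i<n. cmod (toep_mult c' \<kappa> n d i))"
      using n by (intro low') auto
    moreover have "D * (real n * \<eta> * B) = (2 * real n) * (D * B * E / mK)"
      by (simp add: \<eta>_def field_simps)
    ultimately have "(1 - q) * (\<Sum>i<n. cmod (d i)) \<le> (2 * real n) * (D * B * E / mK)"
      by linarith
    \<comment> \<open>\<open>2 * n < 4 * n - 2\<close> follows from \<open>n \<ge> 2\<close>, which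
      makes the estimate strict.\<close>
    also have "\<dots> < (4 * real n - 2) * (D * B * E / mK)"
      using n D E mK P1 p1B by (intro mult_strict_right_mono) auto
    finally have "(\<Sum>i<n. cmod (d i)) < (4 * real n - 2) * (D * B * E / mK) / (1 - q)"
      using assms(26) by (simp only: pos_less_divide_eq mult.commute[of _ "1 - q"] diff_gt_0_iff_gt)
    moreover have "coeff_norm (p1 - approx_p1 n \<kappa> \<alpha>) \<le> (\<Sum>i<n. cmod (d i))"
    proof -
      \<comment> \<open>Both polynomials have coefficient 1 at \<open>\<kappa>\<close>, so only the
        lower coefficients remain.\<close>
      have "coeff_norm (p1 - approx_p1 n \<kappa> \<alpha>) = (\<Sum>t<\<kappa>. cmod (coeff (p1 - approx_p1 n \<kappa> \<alpha>) t))"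
        using assms(14,16) by (intro coeff_norm_eq_sum) (auto simp: coeff_approx_p1 coeff_eq_0)
      also have "\<dots> = (\<Sum>t<\<kappa>. cmod (d (n - \<kappa> + t)))"
        using n by (intro sum.cong) (auto simp: coeff_approx_p1 d_def a_def)
      also have "\<dots> = (\<Sum>j<n. if n \<le> j + \<kappa> then cmod (d j) else 0)"
        using n by (subst sum_top_block) auto
      also have "\<dots> \<le> (\<Sum>i<n. cmod (d i))"
        by (intro sum_mono) auto
      finally show ?thesis .
    qed
    ultimately have "coeff_norm (p1 - approx_p1 n \<kappa> \<alpha>) < (4 * real n - 2) * (D * B * E / mK) / (1 - q)"
      by linarith
    also have "\<dots> = (4 * real n - 2) * D / ((1 - q) * mK) * B * E"
      by (simp add: mult.commute[of mK] mult.assoc)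
    also have "\<dots> = (4 * real n - 2) * \<delta>0 * coeff_norm p / ((1 - q) * mK)
          * (\<delta>0 * (1 + \<rho>) * coeff_norm p / ((1 - q) * (1 - \<rho>) * mK) + 1) * E"
      by (simp add: D_def B_def mult.assoc mult.left_commute[of "coeff_norm p" "1 + \<rho>"] mult.commute[of "coeff_norm p" "1 + \<rho>"])
    finally show ?thesis .
  qed
  show ?thesis
    using ex_alpha ex_beta est_alpha est_beta unfolding c'_def E_def by blast
qed

end
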